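(* Let $p$ be an odd prime with $p\not\equiv\pm1\pmod 8$, let $\delta_p$ be an integer with $8\delta_p\equiv1\pmod{p^2}$, and let $k,n\in\mathbb Z$ with $\left(\frac{k}{p}\right)=1$. Then $$v(p^2n+(pk-7)\delta_p)\equiv 0\pmod 4.$$
   Context: A sequence of integers $a_1,\dots,a_s$ is unimodal of size $n$ if $0<a_1\le\cdots\le a_{k-1}<a_k>a_{k+1}\ge\cdots\ge a_s>0$ for some $k$ and $a_1+\cdots+a_s=n$. It is odd-balanced if the peak $a_k$ is even, the even parts to the left of the peak are distinct, the even parts to the right of the peak are distinct, and the odd parts to the left of the peak are identical (as a multiset) to the odd parts to the right. Let $v(n)$ be the number of odd-balanced unimodal sequences of size $2n+2$; equivalently $\sum_{n\ge0}v(n)q^n=\sum_{n\ge0}\frac{(-q;q)_n^2q^n}{(q;q^2)_{n+1}}$, where $(a;q)_n=\prod_{j=0}^{n-1}(1-aq^j)$. Convention: $v(m)=0$ for $m<0$. $\left(\frac{\cdot}{\cdot}\right)$ is the Kronecker symbol. *)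

theory Defs
  imports "HOL-Number_Theory.Number_Theory" "HOL-Library.Multiset"
begin

text \<open>\<open>a\<close> is the sequence \<open>L\<close>, \<open>m\<close>, \<open>R\<close> with \<open>m\<close> a strict peak; \<open>L\<close> and \<open>R\<close> may be empty.\<close>
definition unimodal_split :: "int list \<Rightarrow> int list \<Rightarrow> int \<Rightarrow> int list \<Rightarrow> bool" where
  "unimodal_split a L m R \<longleftrightarrow>
     a = L @ m # R \<and> (\<forall>x\<in>set a. 0 < x) \<and>
     sorted_wrt (\<le>) L \<and> (\<forall>x\<in>set L. x < m) \<and>
     sorted_wrt (\<ge>) R \<and> (\<forall>x\<in>set R. m > x)"

definition unimodal :: "int \<Rightarrow> int list \<Rightarrow> bool" where
  "unimodal n a \<longleftrightarrow> (\<exists>L m R. unimodal_split a L m R) \<and> sum_list a = n"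

text \<open>The peak is strict, so the decomposition in the following definition is unique.\<close>
definition odd_balanced :: "int list \<Rightarrow> bool" where
  "odd_balanced a \<longleftrightarrow> (\<exists>L m R. unimodal_split a L m R \<and> even m \<and>
     distinct (filter even L) \<and> distinct (filter even R) \<and>
     mset (filter odd L) = mset (filter odd R))"

definition v :: "int \<Rightarrow> nat" where
  "v n = (if n < 0 then 0 else card {a. unimodal (2 * n + 2) a \<and> odd_balanced a})"

end

(*
  Modulo 4 the factors (1 + q^j)^2 of the generating function may be replaced by (1 - q^j)^2.
  A Bailey pair whose beta_n is 1/(q;q^2)_{n+1} then turns the series into
    sum_{k >= 1} (-1)^(k-1) (1 + q^k)/(1 - q^k) sum_{0 <= j < k} q^(k^2 - j(j+1)/2 - 1).
  Put m = 8N + 7 and expand (1 + q^k)/(1 - q^k) = 1 + 2 q^k + 2 q^(2k) + ...  The constant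
  terms contribute to v(N) the solutions of m = 8k^2 - (2j+1)^2; there are none, since p divides
  m exactly once and is inert in Q(sqrt 2).  Hence v(N) is, modulo 4, twice the number of
  (a,b,x) with m = 8ab - x^2, 0 < x < 2a, a < b.  These triples are representatives of binary
  quadratic forms of discriminant -m modulo Gamma_0(2) and its Fricke involution.  The ramified
  prime above p acts on the classes as an involution; genus characters at p, together with
  m mod 8 = 7, show that it has no fixed point, so the number of triples is even.
*)
theory Submission
  imports Defs "HOL-Computational_Algebra.Formal_Power_Series"
begin

section \<open>The Legendre symbol\<close>

text \<open>The modulus 4 has its source in (1 + x)^2 - (1 - x)^2 = 4 x: it turns the numerator
  (-q;q)_n^2 into (q;q)_n^2, the shape that Bailey's lemma can sum. Ideal classes are replaced by
  matrices. Multiplication by the prime above p means being linked by an integral matrix of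
  determinant +-p, and reduced forms serve as representatives. The quotient by the Fricke
  involution, the swap of a and b, is never formed. Since 2 is a nonresidue modulo p, the swap flips
  the genus character at p, so the triples with a < b are as many as the reduced forms with one
  fixed value of that character. The action of p must then preserve this value. Here (k/p) = 1
  enters: m/p is congruent to k and so a residue modulo p, whereas 8 is a nonresidue. A form fixed
  by the action would make m/p an odd square, hence m congruent to p modulo 8, which is impossible
  because p is not 7 modulo 8.\<close>

lemma Legendre_mult:
  fixes p :: int
  assumes "prime p" "odd p"
  shows "Legendre (a * b) p = Legendre a p * Legendre b p"
proof -
  have p2: "p > 2"
    using prime_ge_2_int[OF assms(1)] assms(2) by (cases "p = 2") auto
  obtain q where q: "p = int q" "prime q" "2 < q"
    using assms(1) p2 that[of "nat p"] prime_int_nat_transfer[of p] by linarith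
  let ?e = "(q - 1) div 2"
  have "[Legendre (a * b) p = (a * b) ^ ?e] (mod p)"
    "[Legendre a p * Legendre b p = a ^ ?e * b ^ ?e] (mod p)"
    unfolding q(1) using euler_criterion[OF q(2,3)] cong_mult by blast+
  then have "[Legendre (a * b) p = Legendre a p * Legendre b p] (mod p)"
    by (simp add: cong_def power_mult_distrib)
  then have d: "p dvd Legendre (a * b) p - Legendre a p * Legendre b p"
    by (simp add: cong_iff_dvd_diff)
  \<comment> \<open>Both sides lie in {-1, 0, 1}, so they differ by less than p.\<close>
  have "\<bar>Legendre (a * b) p - Legendre a p * Legendre b p\<bar> < p"
    using p2 by (auto simp: Legendre_def)
  with d have "\<not> 0 < \<bar>Legendre (a * b) p - Legendre a p * Legendre b p\<bar>"
    using zdvd_not_zless dvd_abs_iff by blast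
  then show ?thesis by simp
qed

lemma Legendre_eq_0_iff: "Legendre a p = 0 \<longleftrightarrow> p dvd a"
  by (simp add: Legendre_def cong_0_iff)

lemma Legendre_cong: "[a = b] (mod p) \<Longrightarrow> Legendre a p = Legendre b p"
  by (simp add: Legendre_def QuadRes_def cong_def)

lemma Legendre_square: "\<not> p dvd a \<Longrightarrow> prime p \<Longrightarrow> Legendre (a\<^sup>2) p = 1"
  unfolding Legendre_def cong_0_iff QuadRes_def by (metis cong_refl prime_dvd_power)

lemma Legendre_cases:
  assumes "\<not> p dvd a"
  obtains "Legendre a p = 1" | "Legendre a p = - 1"
  using assms that unfolding Legendre_def cong_0_iff by presburger

text \<open>Gauss's lemma: with h = (p - 1) / 2, the numbers 2 x with x \<le> h that exceed h are h
  - floor(h / 2) in number, which is odd when p is 3 or 5 modulo 8.\<close>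

lemma Legendre_2:
  fixes p :: int
  assumes "prime p" "odd p" "\<not> [p = 1] (mod 8)" "\<not> [p = - 1] (mod 8)"
  shows "Legendre 2 p = - 1"
proof -
  have p2: "p > 2"
    using prime_ge_2_int[OF assms(1)] assms(2) by (cases "p = 2") auto
  obtain q where q: "p = int q" "prime q" "2 < q"
    using assms(1) p2 that[of "nat p"] prime_int_nat_transfer[of p] by linarith
  have "\<not> int q dvd 2" using q(3) zdvd_imp_le[of "int q" 2] by auto
  then interpret GAUSS q 2
    using q by unfold_locales (auto simp: cong_0_iff)
  let ?h = "(int q - 1) div 2"
  have E: "E = (\<lambda>x. 2 * x) ` {?h div 2 <.. ?h}"
  proof -
    have m: "(2 * x) mod int q = 2 * x" if "x \<in> {0<..?h}" for x
      using that p_eq2 by (intro mod_pos_pos_trivial) auto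
    have "C = (\<lambda>x. 2 * x) ` {0<..?h}"
      unfolding C_def B_def A_def image_image
      by (intro image_cong refl) (use m in \<open>simp add: mult.commute\<close>)
    moreover have "?h \<ge> 0" using q(3) by simp
    ultimately show ?thesis
      unfolding E_def by auto
  qed
  have "card E = card {?h div 2 <.. ?h}"
    unfolding E by (rule card_image) (simp add: inj_on_def)
  then have c: "int (card E) = ?h - ?h div 2"
    using q(3) by simp
  have "p mod 8 \<noteq> 1" "p mod 8 \<noteq> 7" "p mod 2 = 1"
    using assms(2-4) by (simp_all add: cong_def odd_iff_mod_2_eq_one)
  then have "p mod 8 = 3 \<or> p mod 8 = 5"
    by presburger
  moreover have "int q = 8 * (p div 8) + p mod 8"
    using q(1) by simp
  ultimately have "odd (?h - ?h div 2)"
    by presburger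
  then have "odd (card E)"
    using c by (metis even_of_nat)
  then show ?thesis
    using gauss_lemma by (simp add: q(1))
qed

lemma even_card_involution:
  assumes "\<And>x. x \<in> X \<Longrightarrow> h x \<in> X" "\<And>x. x \<in> X \<Longrightarrow> h (h x) = x" "\<And>x. x \<in> X \<Longrightarrow> h x \<noteq> x"
  shows "even (card X)"
  using assms
proof (induction "card X" arbitrary: X rule: less_induct)
  case less
  show ?case
  \<comment> \<open>An infinite \<open>X\<close> has \<open>card X = 0\<close> and falls under this
    case.\<close>
  proof (cases "card X = 0")
    case False
    then obtain x where x: "x \<in> X" and fin: "finite X"
      by (metis card.empty card.infinite ex_in_conv)
    let ?Y = "X - {x, h x}"
    have c: "card X = card ?Y + 2"
      using fin x less.prems(1,3)[OF x] card_Diff_subset[of "{x, h x}" X]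
        card_mono[OF fin, of "{x, h x}"] by fastforce
    have "even (card ?Y)"
    proof (rule less.hyps)
      show "card ?Y < card X" using c by simp
      fix y assume y: "y \<in> ?Y"
      show "h (h y) = y" "h y \<noteq> y" using y less.prems by auto
      show "h y \<in> ?Y" using y x less.prems(1,2) by (metis Diff_iff insert_iff singletonD)
    qed
    then show ?thesis using c by simp
  qed simp
qed

section \<open>Classes of binary quadratic forms for Gamma_0(2)\<close>

text \<open>
  The triple \<open>(a, b, x)\<close> stands for the form \<open>a X\<^sup>2 + x X Y + 2 b Y\<^sup>2\<close>. The pull-back of the first
  form along the matrix with rows \<open>\<alpha>, 2 \<beta>\<close> and \<open>\<gamma>, \<delta>\<close> is \<open>d\<close> times the second one. So \<open>sim 1\<close> is
  equivalence under \<open>\<Gamma>\<^sub>0(2)\<close> with reflections added, and for a ramified prime \<open>p\<close> the relation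
  \<open>sim p\<close> is multiplication by the prime ideal above \<open>p\<close>.
\<close>
definition sim :: "int \<Rightarrow> int \<times> int \<times> int \<Rightarrow> int \<times> int \<times> int \<Rightarrow> bool" where
  "sim d = (\<lambda>(a, b, x) (a', b', x'). \<exists>\<alpha> \<beta> \<gamma> \<delta>. \<bar>\<alpha> * \<delta> - 2 * \<beta> * \<gamma>\<bar> = d \<and>
     d * a' = a * \<alpha>\<^sup>2 + x * \<alpha> * \<gamma> + 2 * b * \<gamma>\<^sup>2 \<and>
     d * b' = 2 * a * \<beta>\<^sup>2 + x * \<beta> * \<delta> + b * \<delta>\<^sup>2 \<and>
     d * x' = 4 * a * \<alpha> * \<beta> + x * (\<alpha> * \<delta> + 2 * \<beta> * \<gamma>) + 4 * b * \<gamma> * \<delta>)"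

definition forms :: "int \<Rightarrow> (int \<times> int \<times> int) set" where
  "forms m = {(a, b, x). 0 < a \<and> 0 < b \<and> 8 * a * b - x\<^sup>2 = m}"

text \<open>A fundamental domain: the two unipotent generators shift x by multiples of 4 a and of 4
  b, and reflections make x positive. Strict inequalities suffice because x is odd when m is. The
  conditions are symmetric in a and b, as the Fricke swap requires.\<close>

definition reduced :: "int \<Rightarrow> (int \<times> int \<times> int) set" where
  "reduced m = {(a, b, x). 0 < x \<and> x < 2 * a \<and> x < 2 * b \<and> 8 * a * b - x\<^sup>2 = m}"

lemma simI:
  assumes "\<bar>\<alpha> * \<delta> - 2 * \<beta> * \<gamma>\<bar> = d"
    "d * a' = a * \<alpha>\<^sup>2 + x * \<alpha> * \<gamma> + 2 * b * \<gamma>\<^sup>2"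
    "d * b' = 2 * a * \<beta>\<^sup>2 + x * \<beta> * \<delta> + b * \<delta>\<^sup>2"
    "d * x' = 4 * a * \<alpha> * \<beta> + x * (\<alpha> * \<delta> + 2 * \<beta> * \<gamma>) + 4 * b * \<gamma> * \<delta>"
  shows "sim d (a, b, x) (a', b', x')"
  using assms unfolding sim_def by blast

lemma simE:
  assumes "sim d (a, b, x) (a', b', x')"
  obtains \<alpha> \<beta> \<gamma> \<delta> where "\<bar>\<alpha> * \<delta> - 2 * \<beta> * \<gamma>\<bar> = d"
    "d * a' = a * \<alpha>\<^sup>2 + x * \<alpha> * \<gamma> + 2 * b * \<gamma>\<^sup>2"
    "d * b' = 2 * a * \<beta>\<^sup>2 + x * \<beta> * \<delta> + b * \<delta>\<^sup>2"
    "d * x' = 4 * a * \<alpha> * \<beta> + x * (\<alpha> * \<delta> + 2 * \<beta> * \<gamma>) + 4 * b * \<gamma> * \<delta>"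
  using assms unfolding sim_def by blast

lemma sim_disc:
  assumes "sim d (a, b, x) (a', b', x')" "d > 0"
  shows "8 * a' * b' - x'\<^sup>2 = 8 * a * b - x\<^sup>2"
proof -
  obtain \<alpha> \<beta> \<gamma> \<delta> where M: "\<bar>\<alpha> * \<delta> - 2 * \<beta> * \<gamma>\<bar> = d"
    and e: "d * a' = a * \<alpha>\<^sup>2 + x * \<alpha> * \<gamma> + 2 * b * \<gamma>\<^sup>2"
    "d * b' = 2 * a * \<beta>\<^sup>2 + x * \<beta> * \<delta> + b * \<delta>\<^sup>2"
    "d * x' = 4 * a * \<alpha> * \<beta> + x * (\<alpha> * \<delta> + 2 * \<beta> * \<gamma>) + 4 * b * \<gamma> * \<delta>"
    using assms(1) by (rule simE)
  have "d\<^sup>2 * (8 * a' * b' - x'\<^sup>2) = 8 * (d * a') * (d * b') - (d * x')\<^sup>2"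
    by (simp add: algebra_simps power2_eq_square)
  also have "\<dots> = (\<alpha> * \<delta> - 2 * \<beta> * \<gamma>)\<^sup>2 * (8 * a * b - x\<^sup>2)"
    unfolding e by (simp add: algebra_simps power2_eq_square)
  also have "\<dots> = d\<^sup>2 * (8 * a * b - x\<^sup>2)"
    using M by (metis power2_abs)
  finally show ?thesis
    using assms(2) by simp
qed

lemma sim_trans:
  assumes "sim d u t" "sim e t w"
  shows "sim (d * e) u w"
proof -
  obtain a b x where u: "u = (a, b, x)" by (cases u) auto
  obtain a' b' x' where t: "t = (a', b', x')" by (cases t) auto
  obtain a2 b2 x2 where w: "w = (a2, b2, x2)" by (cases w) auto
  obtain \<alpha> \<beta> \<gamma> \<delta> where M: "\<bar>\<alpha> * \<delta> - 2 * \<beta> * \<gamma>\<bar> = d"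
    and e: "d * a' = a * \<alpha>\<^sup>2 + x * \<alpha> * \<gamma> + 2 * b * \<gamma>\<^sup>2"
    "d * b' = 2 * a * \<beta>\<^sup>2 + x * \<beta> * \<delta> + b * \<delta>\<^sup>2"
    "d * x' = 4 * a * \<alpha> * \<beta> + x * (\<alpha> * \<delta> + 2 * \<beta> * \<gamma>) + 4 * b * \<gamma> * \<delta>"
    using assms(1) unfolding u t by (rule simE)
  obtain A B C D where M': "\<bar>A * D - 2 * B * C\<bar> = e"
    and e': "e * a2 = a' * A\<^sup>2 + x' * A * C + 2 * b' * C\<^sup>2"
    "e * b2 = 2 * a' * B\<^sup>2 + x' * B * D + b' * D\<^sup>2"
    "e * x2 = 4 * a' * A * B + x' * (A * D + 2 * B * C) + 4 * b' * C * D"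
    using assms(2) unfolding t w by (rule simE)
  show ?thesis
    unfolding u w
  \<comment> \<open>The entries of the product of the two matrices; its upper right entry is again
    even.\<close>
  proof (rule simI[where \<alpha> = "\<alpha> * A + 2 * \<beta> * C" and \<beta> = "\<alpha> * B + \<beta> * D"
        and \<gamma> = "\<gamma> * A + \<delta> * C" and \<delta> = "2 * \<gamma> * B + \<delta> * D"])
    have "(\<alpha> * A + 2 * \<beta> * C) * (2 * \<gamma> * B + \<delta> * D) - 2 * (\<alpha> * B + \<beta> * D) * (\<gamma> * A + \<delta> * C)
      = (\<alpha> * \<delta> - 2 * \<beta> * \<gamma>) * (A * D - 2 * B * C)"
      by (simp add: algebra_simps power2_eq_square)
    then show "\<bar>(\<alpha> * A + 2 * \<beta> * C) * (2 * \<gamma> * B + \<delta> * D) - 2 * (\<alpha> * B + \<beta> * D) * (\<gamma> * A + \<delta> * C)\<bar>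
      = d * e"
      using M M' by (simp add: abs_mult)
  next
    have "d * e * a2 = (d * a') * A\<^sup>2 + (d * x') * A * C + 2 * (d * b') * C\<^sup>2"
      unfolding mult.assoc[of d e] e'(1) by (simp add: algebra_simps)
    then show "d * e * a2 = a * (\<alpha> * A + 2 * \<beta> * C)\<^sup>2 + x * (\<alpha> * A + 2 * \<beta> * C) * (\<gamma> * A + \<delta> * C)
      + 2 * b * (\<gamma> * A + \<delta> * C)\<^sup>2"
      unfolding e by (simp add: algebra_simps power2_eq_square)
  next
    have "d * e * b2 = 2 * (d * a') * B\<^sup>2 + (d * x') * B * D + (d * b') * D\<^sup>2"
      unfolding mult.assoc[of d e] e'(2) by (simp add: algebra_simps)
    then show "d * e * b2 = 2 * a * (\<alpha> * B + \<beta> * D)\<^sup>2 + x * (\<alpha> * B + \<beta> * D) * (2 * \<gamma> * B + \<delta> * D)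
      + b * (2 * \<gamma> * B + \<delta> * D)\<^sup>2"
      unfolding e by (simp add: algebra_simps power2_eq_square)
  next
    have "d * e * x2 = 4 * (d * a') * A * B + (d * x') * (A * D + 2 * B * C) + 4 * (d * b') * C * D"
      unfolding mult.assoc[of d e] e'(3) by (simp add: algebra_simps)
    then show "d * e * x2 = 4 * a * (\<alpha> * A + 2 * \<beta> * C) * (\<alpha> * B + \<beta> * D)
      + x * ((\<alpha> * A + 2 * \<beta> * C) * (2 * \<gamma> * B + \<delta> * D) + 2 * (\<alpha> * B + \<beta> * D) * (\<gamma> * A + \<delta> * C))
      + 4 * b * (\<gamma> * A + \<delta> * C) * (2 * \<gamma> * B + \<delta> * D)"
      unfolding e by (simp add: algebra_simps power2_eq_square)
  qed
qed

text \<open>The adjugate matrix leads back: pulling back along both matrices multiplies the form by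
  the squared determinant d^2, and one factor d has already been divided out.\<close>

lemma sim_sym:
  assumes "sim d u t" "d > 0"
  shows "sim d t u"
proof -
  obtain a b x where u: "u = (a, b, x)" by (cases u) auto
  obtain a' b' x' where t: "t = (a', b', x')" by (cases t) auto
  obtain \<alpha> \<beta> \<gamma> \<delta> where M: "\<bar>\<alpha> * \<delta> - 2 * \<beta> * \<gamma>\<bar> = d"
    and e: "d * a' = a * \<alpha>\<^sup>2 + x * \<alpha> * \<gamma> + 2 * b * \<gamma>\<^sup>2"
    "d * b' = 2 * a * \<beta>\<^sup>2 + x * \<beta> * \<delta> + b * \<delta>\<^sup>2"
    "d * x' = 4 * a * \<alpha> * \<beta> + x * (\<alpha> * \<delta> + 2 * \<beta> * \<gamma>) + 4 * b * \<gamma> * \<delta>"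
    using assms(1) unfolding u t by (rule simE)
  have d2: "d\<^sup>2 = (\<alpha> * \<delta> - 2 * \<beta> * \<gamma>)\<^sup>2"
    using M by (metis power2_abs)
  show ?thesis
    unfolding u t
  proof (rule simI[where \<alpha> = \<delta> and \<beta> = "- \<beta>" and \<gamma> = "- \<gamma>" and \<delta> = \<alpha>])
    show "\<bar>\<delta> * \<alpha> - 2 * - \<beta> * - \<gamma>\<bar> = d"
      using M by (simp add: mult.commute)
  next
    have "d * (d * a) = d\<^sup>2 * a" by (simp add: algebra_simps power2_eq_square)
    also have "\<dots> = (d * a') * \<delta>\<^sup>2 + (d * x') * \<delta> * - \<gamma> + 2 * (d * b') * (- \<gamma>)\<^sup>2"
      unfolding e d2 by (simp add: algebra_simps power2_eq_square)
    also have "\<dots> = d * (a' * \<delta>\<^sup>2 + x' * \<delta> * - \<gamma> + 2 * b' * (- \<gamma>)\<^sup>2)" by (simp add: algebra_simps power2_eq_square)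
    finally show "d * a = a' * \<delta>\<^sup>2 + x' * \<delta> * - \<gamma> + 2 * b' * (- \<gamma>)\<^sup>2"
      using assms(2) by (metis less_irrefl mult_left_cancel)
  next
    have "d * (d * b) = d\<^sup>2 * b" by (simp add: algebra_simps power2_eq_square)
    also have "\<dots> = 2 * (d * a') * (- \<beta>)\<^sup>2 + (d * x') * - \<beta> * \<alpha> + (d * b') * \<alpha>\<^sup>2"
      unfolding e d2 by (simp add: algebra_simps power2_eq_square)
    also have "\<dots> = d * (2 * a' * (- \<beta>)\<^sup>2 + x' * - \<beta> * \<alpha> + b' * \<alpha>\<^sup>2)" by (simp add: algebra_simps power2_eq_square)
    finally show "d * b = 2 * a' * (- \<beta>)\<^sup>2 + x' * - \<beta> * \<alpha> + b' * \<alpha>\<^sup>2"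
      using assms(2) by (metis less_irrefl mult_left_cancel)
  next
    have "d * (d * x) = d\<^sup>2 * x" by (simp add: algebra_simps power2_eq_square)
    also have "\<dots> = 4 * (d * a') * \<delta> * - \<beta> + (d * x') * (\<delta> * \<alpha> + 2 * - \<beta> * - \<gamma>) + 4 * (d * b') * - \<gamma> * \<alpha>"
      unfolding e d2 by (simp add: algebra_simps power2_eq_square)
    also have "\<dots> = d * (4 * a' * \<delta> * - \<beta> + x' * (\<delta> * \<alpha> + 2 * - \<beta> * - \<gamma>) + 4 * b' * - \<gamma> * \<alpha>)" by (simp add: algebra_simps power2_eq_square)
    finally show "d * x = 4 * a' * \<delta> * - \<beta> + x' * (\<delta> * \<alpha> + 2 * - \<beta> * - \<gamma>) + 4 * b' * - \<gamma> * \<alpha>"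
      using assms(2) by (metis less_irrefl mult_left_cancel)
  qed
qed

text \<open>Completing the square gives a' \<ge> 0; the unchanged positive m then forces a' b' >
  0.\<close>

lemma sim_forms:
  assumes "sim d u t" "d > 0" "u \<in> forms m" "m > 0"
  shows "t \<in> forms m"
proof -
  obtain a b x where u: "u = (a, b, x)" by (cases u) auto
  obtain a' b' x' where t: "t = (a', b', x')" by (cases t) auto
  obtain \<alpha> \<beta> \<gamma> \<delta> where M: "\<bar>\<alpha> * \<delta> - 2 * \<beta> * \<gamma>\<bar> = d"
    and e: "d * a' = a * \<alpha>\<^sup>2 + x * \<alpha> * \<gamma> + 2 * b * \<gamma>\<^sup>2"
    using assms(1) unfolding u t by (rule simE)
  have a: "a > 0" and m: "8 * a * b - x\<^sup>2 = m"
    using assms(3) unfolding u forms_def by auto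
  have m': "8 * a' * b' - x'\<^sup>2 = m"
    using sim_disc assms(1,2) m unfolding u t by metis
  have "4 * a * (d * a') = (2 * a * \<alpha> + x * \<gamma>)\<^sup>2 + m * \<gamma>\<^sup>2"
    unfolding e m[symmetric] by (simp add: algebra_simps power2_eq_square)
  then have "4 * a * (d * a') \<ge> 0"
    using assms(4) by simp
  then have "a' \<ge> 0"
    using a assms(2) by (simp add: zero_le_mult_iff)
  moreover have p: "8 * (a' * b') > 0"
    using m' assms(4) zero_le_power2[of x'] unfolding mult.assoc by linarith
  ultimately show ?thesis
    using m' unfolding t forms_def by (auto simp: zero_less_mult_iff)
qed

section \<open>Reduction theory: existence and uniqueness of reduced forms\<close>

lemma reduced_subset: "reduced m \<subseteq> forms m"
  unfolding reduced_def forms_def by auto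

text \<open>Descent on a + b. If \<bar>x\<bar> exceeds 2 a, shifting x by 4 a lowers b; if it
  exceeds 2 b, shifting by 4 b lowers a. Ties cannot occur because x is odd.\<close>

lemma sim_reduce:
  assumes "m > 0" "odd m" "u \<in> forms m"
  shows "\<exists>t \<in> reduced m. sim 1 u t"
  using assms(3)
proof (induction "nat (fst u + fst (snd u))" arbitrary: u rule: less_induct)
  case less
  obtain a b x where u: "u = (a, b, x)" by (cases u) auto
  have ab: "a > 0" "b > 0" and m: "8 * a * b - x\<^sup>2 = m"
    using less.prems unfolding u forms_def by auto
  have "odd x"
    using assms(2) unfolding m[symmetric] by simp
  have step: ?case if st: "sim 1 u (a', b', x')" "a' + b' < a + b" for a' b' x'
  proof -
    have t: "(a', b', x') \<in> forms m"
      using sim_forms[OF st(1) _ less.prems assms(1)] by simp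
    from t have "a' + b' > 0" unfolding forms_def by auto
    obtain w where w: "w \<in> reduced m" "sim 1 (a', b', x') w"
      using less.hyps[OF _ t] st(2) ab by (auto simp: u)
    then show ?case
      using sim_trans[OF st(1) w(2)] by auto
  qed
  define s where "s = sgn x"
  have s: "s * x = \<bar>x\<bar>" "s\<^sup>2 = 1"
    using \<open>odd x\<close> unfolding s_def by (auto simp: sgn_if)
  consider "\<bar>x\<bar> > 2 * a" | "\<bar>x\<bar> > 2 * b" | "\<bar>x\<bar> < 2 * a" "\<bar>x\<bar> < 2 * b"
  proof -
    have "\<bar>x\<bar> \<noteq> 2 * a" "\<bar>x\<bar> \<noteq> 2 * b"
      using \<open>odd x\<close> by (metis dvd_abs_iff dvd_triv_left)+
    then show ?thesis
      using that by linarith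
  qed
  then show ?case
  proof cases
    case 1
    have "sim 1 u (a, 2 * a - \<bar>x\<bar> + b, x - 4 * a * s)"
      unfolding u s(1)[symmetric]
      by (rule simI[where \<alpha> = 1 and \<beta> = "- s" and \<gamma> = 0 and \<delta> = 1]) (use s(2) in \<open>simp_all add: algebra_simps\<close>)
    then show ?thesis
      by (rule step) (use 1 in simp)
  next
    case 2
    have "sim 1 u (a - \<bar>x\<bar> + 2 * b, b, x - 4 * b * s)"
      unfolding u s(1)[symmetric]
      by (rule simI[where \<alpha> = 1 and \<beta> = 0 and \<gamma> = "- s" and \<delta> = 1]) (use s(2) in \<open>simp_all add: algebra_simps\<close>)
    then show ?thesis
      by (rule step) (use 2 in simp)
  next
    case 3
    have "(a, b, \<bar>x\<bar>) \<in> reduced m"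
      using 3 \<open>odd x\<close> m unfolding reduced_def by auto
    moreover have "sim 1 u (a, b, \<bar>x\<bar>)"
      unfolding u s(1)[symmetric]
      by (rule simI[where \<alpha> = 1 and \<beta> = 0 and \<gamma> = 0 and \<delta> = s])
        (use s(2) \<open>odd x\<close> in \<open>auto simp add: algebra_simps s_def abs_sgn_eq\<close>)
    ultimately show ?thesis by blast
  qed
qed

text \<open>Twice the value is (2 a - x) \<alpha>^2 + (4 b - 2 x) \<gamma>^2 + x ((\<alpha> +
  \<gamma>)^2 + \<gamma>^2) with positive coefficients. For nonzero \<alpha> and \<gamma> it is at
  least 2 a + 4 b - 2 x, which exceeds 2 a. Odd \<alpha> is what the first column of a matrix of
  determinant +-1 provides.\<close>

lemma reduced_min:
  assumes "(a, b, x) \<in> reduced m" "odd \<alpha>" "a * \<alpha>\<^sup>2 + x * \<alpha> * \<gamma> + 2 * b * \<gamma>\<^sup>2 \<le> a"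
  shows "\<gamma> = 0"
proof (rule ccontr)
  assume g: "\<gamma> \<noteq> 0"
  have r: "0 < x" "x < 2 * a" "x < 2 * b"
    using assms(1) unfolding reduced_def by auto
  have sq: "z\<^sup>2 \<ge> 1" if "z \<noteq> 0" for z :: int
    using that by (metis int_one_le_iff_zero_less zero_less_power2)
  have "\<alpha> \<noteq> 0" using assms(2) by auto
  define P where "P = (2 * a - x) * \<alpha>\<^sup>2"
  define Q where "Q = (4 * b - 2 * x) * \<gamma>\<^sup>2"
  define R where "R = x * ((\<alpha> + \<gamma>)\<^sup>2 + \<gamma>\<^sup>2)"
  have "(\<alpha> + \<gamma>)\<^sup>2 + \<gamma>\<^sup>2 \<ge> 1"
    using sq[OF g] zero_le_power2[of "\<alpha> + \<gamma>"] by linarith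
  then have "R \<ge> x"
    unfolding R_def using r(1) mult_left_mono[of 1 _ x] by fastforce
  moreover have "P \<ge> 2 * a - x"
    unfolding P_def using r sq[OF \<open>\<alpha> \<noteq> 0\<close>] mult_left_mono[of 1 _ "2 * a - x"] by fastforce
  moreover have "Q \<ge> 4 * b - 2 * x"
    unfolding Q_def using r sq[OF g] mult_left_mono[of 1 _ "4 * b - 2 * x"] by fastforce
  moreover have "P + Q + R = 2 * (a * \<alpha>\<^sup>2 + x * \<alpha> * \<gamma> + 2 * b * \<gamma>\<^sup>2)"
    unfolding P_def Q_def R_def by (simp add: algebra_simps power2_eq_square)
  then have "P + Q + R \<le> 2 * a"
    using assms(3) by simp
  ultimately show False
    using r by linarith
qed

lemma sim_reduced_le:
  assumes "u \<in> reduced m" "t \<in> reduced m" "sim 1 u t"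
  shows "fst u \<le> fst t"
proof (rule ccontr)
  assume n: "\<not> fst u \<le> fst t"
  obtain a b x where u: "u = (a, b, x)" by (cases u) auto
  obtain a' b' x' where t: "t = (a', b', x')" by (cases t) auto
  obtain \<alpha> \<beta> \<gamma> \<delta> where M: "\<bar>\<alpha> * \<delta> - 2 * \<beta> * \<gamma>\<bar> = 1"
    and e: "1 * a' = a * \<alpha>\<^sup>2 + x * \<alpha> * \<gamma> + 2 * b * \<gamma>\<^sup>2"
    using assms(3) unfolding u t by (rule simE)
  have "odd (\<alpha> * \<delta> - 2 * \<beta> * \<gamma>)"
    using M by (metis dvd_abs_iff odd_one)
  then have "odd \<alpha>" by simp
  have "\<gamma> = 0"
    using reduced_min[OF assms(1)[unfolded u] \<open>odd \<alpha>\<close>] e n unfolding u t by auto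
  then have "a' = a * \<alpha>\<^sup>2" "\<bar>\<alpha>\<bar> = 1"
    using e M by (auto simp: zmult_eq_1_iff abs_mult)
  then show False
    using n unfolding u t by (metis fst_conv mult.right_neutral one_power2 order_refl power2_abs)
qed

text \<open>Equivalent reduced forms share their first coefficient, by minimality in both
  directions. Then \<gamma> = 0, the diagonal entries are +-1, and x' is +-x modulo 4 a; the bounds
  0 < x, x' < 2 a leave only x' = x.\<close>

lemma sim_reduced_unique:
  assumes "u \<in> reduced m" "t \<in> reduced m" "sim 1 u t"
  shows "u = t"
proof -
  obtain a b x where u: "u = (a, b, x)" by (cases u) auto
  obtain a' b' x' where t: "t = (a', b', x')" by (cases t) auto
  have aa: "a' = a"
    using sim_reduced_le[OF assms] sim_reduced_le[OF assms(2,1) sim_sym[OF assms(3)]] unfolding u t by simp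
  obtain \<alpha> \<beta> \<gamma> \<delta> where M: "\<bar>\<alpha> * \<delta> - 2 * \<beta> * \<gamma>\<bar> = 1"
    and e: "1 * a' = a * \<alpha>\<^sup>2 + x * \<alpha> * \<gamma> + 2 * b * \<gamma>\<^sup>2"
    "1 * b' = 2 * a * \<beta>\<^sup>2 + x * \<beta> * \<delta> + b * \<delta>\<^sup>2"
    "1 * x' = 4 * a * \<alpha> * \<beta> + x * (\<alpha> * \<delta> + 2 * \<beta> * \<gamma>) + 4 * b * \<gamma> * \<delta>"
    using assms(3) unfolding u t by (rule simE)
  have "odd (\<alpha> * \<delta> - 2 * \<beta> * \<gamma>)"
    using M by (metis dvd_abs_iff odd_one)
  then have "odd \<alpha>" by simp
  have g: "\<gamma> = 0"
    using reduced_min[OF assms(1)[unfolded u] \<open>odd \<alpha>\<close>] e aa by auto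
  then have al: "\<bar>\<alpha>\<bar> = 1" "\<bar>\<delta>\<bar> = 1"
    using M by (auto simp: zmult_eq_1_iff abs_mult)
  have r: "0 < x" "x < 2 * a" "0 < x'" "x' < 2 * a"
    using assms(1,2) unfolding reduced_def u t aa by auto
  have x': "x' = 4 * a * (\<alpha> * \<beta>) + x * (\<alpha> * \<delta>)"
    using e(3) g by simp
  have "\<bar>x * (\<alpha> * \<delta>)\<bar> < 2 * a"
    using al r by (simp add: abs_mult)
  then have "\<bar>4 * a * (\<alpha> * \<beta>)\<bar> < 4 * a"
    using x' r by linarith
  then have "\<bar>\<alpha> * \<beta>\<bar> < 1"
    using r by (simp add: abs_mult)
  then have "\<beta> = 0" using al by auto
  then have "\<bar>x'\<bar> = \<bar>x\<bar>"
    using x' al by (simp add: abs_mult)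
  then have "x' = x" using r by simp
  moreover have "b' = b"
    using e(2) \<open>\<beta> = 0\<close> al by (metis add_0 mult.right_neutral mult_1 mult_zero_left mult_zero_right one_power2 power2_abs power_zero_numeral)
  ultimately show ?thesis
    unfolding u t aa by simp
qed

text \<open>
  The genus character at \<open>p\<close>, read off from the companion form \<open>2 a X\<^sup>2 + x X Y + b Y\<^sup>2\<close>. Swapping
  \<open>a\<close> and \<open>b\<close> (the Fricke involution) multiplies its values by 2 up to squares.
\<close>
definition residual :: "int \<Rightarrow> int \<times> int \<times> int \<Rightarrow> bool" where
  "residual p = (\<lambda>(a, b, x). \<exists>X Y. Legendre (2 * a * X\<^sup>2 + x * X * Y + b * Y\<^sup>2) p = 1)"

text \<open>The companion form transforms under the matrix with rows \<alpha>, \<beta> and 2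
  \<gamma>, \<delta>, so every value it takes for \<open>w\<close> is also taken for
  \<open>u\<close>.\<close>

lemma sim_residual:
  assumes "sim 1 u w" "residual p w"
  shows "residual p u"
proof -
  obtain a b x where u: "u = (a, b, x)" by (cases u) auto
  obtain a' b' x' where w: "w = (a', b', x')" by (cases w) auto
  obtain \<alpha> \<beta> \<gamma> \<delta> where M: "\<bar>\<alpha> * \<delta> - 2 * \<beta> * \<gamma>\<bar> = 1"
    and e: "1 * a' = a * \<alpha>\<^sup>2 + x * \<alpha> * \<gamma> + 2 * b * \<gamma>\<^sup>2"
    "1 * b' = 2 * a * \<beta>\<^sup>2 + x * \<beta> * \<delta> + b * \<delta>\<^sup>2"
    "1 * x' = 4 * a * \<alpha> * \<beta> + x * (\<alpha> * \<delta> + 2 * \<beta> * \<gamma>) + 4 * b * \<gamma> * \<delta>"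
    using assms(1) unfolding u w by (rule simE)
  obtain X Y where XY: "Legendre (2 * a' * X\<^sup>2 + x' * X * Y + b' * Y\<^sup>2) p = 1"
    using assms(2) unfolding w residual_def by auto
  have "2 * a' * X\<^sup>2 + x' * X * Y + b' * Y\<^sup>2 = 2 * a * (\<alpha> * X + \<beta> * Y)\<^sup>2
    + x * (\<alpha> * X + \<beta> * Y) * (2 * \<gamma> * X + \<delta> * Y) + b * (2 * \<gamma> * X + \<delta> * Y)\<^sup>2"
    unfolding e[simplified] by (simp add: algebra_simps power2_eq_square)
  then show ?thesis
    using XY unfolding u residual_def by auto
qed

section \<open>The action of the ramified prime above p on classes\<close>

lemma odd_square_mod_8:
  fixes c :: int
  assumes "odd c"
  shows "c\<^sup>2 mod 8 = 1"
proof -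
  obtain k where k: "c = 2 * k + 1" using assms by (rule oddE)
  have "even (k * (k + 1))" by simp
  then obtain j where "k * (k + 1) = 2 * j" by blast
  then have "c\<^sup>2 = 8 * j + 1"
    unfolding k by (simp add: algebra_simps power2_eq_square)
  then show ?thesis by simp
qed

text \<open>Here p ramifies in Q(sqrt(-m)) and is inert in Q(sqrt 2). \<open>Lm'\<close> makes the
  action of p respect the genus character; \<open>m7\<close> and \<open>p7\<close> together keep m'
  from being an odd square.\<close>

locale inert_disc =
  fixes p m' m :: int
  assumes prime_p: "prime p" and odd_p: "odd p" and p7: "p mod 8 \<noteq> 7"
    and L2: "Legendre 2 p = - 1" and Lm': "Legendre m' p = 1"
    and m_eq: "m = p * m'" and m7: "m mod 8 = 7" and m_pos: "m > 0"
begin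

lemma p_gt_2: "p > 2"
  using prime_ge_2_int[OF prime_p] odd_p by (cases "p = 2") auto

lemma p_not_dvd_2: "\<not> p dvd 2"
  using p_gt_2 zdvd_imp_le by force

lemma p_not_dvd_4: "\<not> p dvd 4"
  using prime_dvd_mult_iff[OF prime_p, of 2 2] p_not_dvd_2 by simp

lemma p_not_dvd_8: "\<not> p dvd 8"
  using prime_dvd_mult_iff[OF prime_p, of 2 4] p_not_dvd_2 p_not_dvd_4 by simp

lemma p_not_dvd_m': "\<not> p dvd m'"
  using Lm' Legendre_eq_0_iff[of m' p] by auto

lemma not_p2_dvd_m: "\<not> p\<^sup>2 dvd m"
  using p_not_dvd_m' p_gt_2 unfolding m_eq power2_eq_square by simp

lemma odd_m: "odd m"
  using m7 by presburger

lemma Lmult: "Legendre (a * b) p = Legendre a p * Legendre b p"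
  by (rule Legendre_mult[OF prime_p odd_p])

lemma L4: "Legendre 4 p = 1"
  using Lmult[of 2 2] L2 by simp

text \<open>Otherwise p divides x as well, and then p^2 divides m.\<close>

lemma forms_not_both_dvd:
  assumes "(a, b, x) \<in> forms m"
  shows "\<not> (p dvd a \<and> p dvd b)"
proof
  assume ab: "p dvd a \<and> p dvd b"
  have m: "x\<^sup>2 = 8 * a * b - m"
    using assms unfolding forms_def by auto
  have "p dvd x\<^sup>2"
    unfolding m m_eq using ab by (simp add: dvd_diff)
  then have "p dvd x" using prime_p prime_dvd_power by blast
  then have "p\<^sup>2 dvd x\<^sup>2" "p\<^sup>2 dvd 8 * a * b"
    using ab by (auto simp: power2_eq_square mult.assoc intro: mult_dvd_mono dvd_mult)
  then have "p\<^sup>2 dvd 8 * a * b - x\<^sup>2"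
    by (rule dvd_diff[rotated])
  then show False
    using not_p2_dvd_m m by simp
qed

text \<open>For two values f, g of the companion form, 4 f g is a square plus m times the square of
  a determinant, hence a square modulo p. All values prime to p therefore have the same Legendre
  symbol, and any one of them decides.\<close>

lemma residual_iff:
  assumes "(a, b, x) \<in> forms m" "\<not> p dvd 2 * a * X\<^sup>2 + x * X * Y + b * Y\<^sup>2" (is "\<not> p dvd ?f")
  shows "residual p (a, b, x) \<longleftrightarrow> Legendre (2 * a * X\<^sup>2 + x * X * Y + b * Y\<^sup>2) p = 1"
proof
  assume "residual p (a, b, x)"
  then obtain Z T where g: "Legendre (2 * a * Z\<^sup>2 + x * Z * T + b * T\<^sup>2) p = 1" (is "Legendre ?g p = 1")
    unfolding residual_def by auto
  have m: "m = 8 * a * b - x\<^sup>2"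
    using assms unfolding forms_def by auto
  define B where "B = 4 * a * X * Z + x * (X * T + Z * Y) + 2 * b * Y * T"
  have "4 * (?f * ?g) = B\<^sup>2 + m * (X * T - Z * Y)\<^sup>2"
    unfolding B_def m by (simp add: algebra_simps power2_eq_square)
  then have c: "[4 * (?f * ?g) = B\<^sup>2] (mod p)"
    unfolding m_eq by (simp add: cong_iff_dvd_diff)
  have ng: "\<not> p dvd ?g" using g by (metis Legendre_eq_0_iff zero_neq_one)
  then have "\<not> p dvd 4 * (?f * ?g)"
    using assms(2) p_not_dvd_4 prime_dvd_mult_iff[OF prime_p] by blast
  then have "\<not> p dvd B\<^sup>2"
    using c cong_dvd_iff by blast
  then have "\<not> p dvd B" by (auto simp: power2_eq_square)
  then have "Legendre (4 * (?f * ?g)) p = 1"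
    using Legendre_cong[OF c] Legendre_square prime_p by simp
  then show "Legendre ?f p = 1"
    using g L4 Lmult by simp
qed (auto simp: residual_def)

lemma residual_iff_b:
  assumes "(a, b, x) \<in> forms m" "\<not> p dvd b"
  shows "residual p (a, b, x) \<longleftrightarrow> Legendre b p = 1"
  using residual_iff[OF assms(1), of 0 1] assms(2) by simp

lemma residual_iff_a:
  assumes "(a, b, x) \<in> forms m" "\<not> p dvd a"
  shows "residual p (a, b, x) \<longleftrightarrow> Legendre a p = - 1"
proof -
  have "\<not> p dvd 2 * a"
    using assms(2) p_not_dvd_2 prime_dvd_mult_iff[OF prime_p] by blast
  then show ?thesis
    using residual_iff[OF assms(1), of 1 0] L2 by (simp add: Lmult)
qed

text \<open>One of a, b is prime to p. For one of the two forms it is the companion value at (0, 1);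
  for the other the value at (1, 0) is twice it, and 2 is a nonresidue.\<close>

lemma residual_swap:
  assumes "(a, b, x) \<in> forms m"
  shows "residual p (b, a, x) \<longleftrightarrow> \<not> residual p (a, b, x)"
proof -
  have s: "(b, a, x) \<in> forms m"
    using assms unfolding forms_def by (auto simp: mult_ac)
  show ?thesis
  proof (cases "p dvd b")
    case True
    then have "\<not> p dvd a" using forms_not_both_dvd[OF assms] by blast
    then show ?thesis
      using residual_iff_a[OF assms] residual_iff_b[OF s] Legendre_cases[of p a] by fastforce
  next
    case False
    then show ?thesis
      using residual_iff_b[OF assms] residual_iff_a[OF s] Legendre_cases[of p b] by fastforce
  qed
qed

text \<open>Modulo p the form has a double root, since p divides m. A matrix of determinant p whose
  first column lies on that root yields a form divisible by p.\<close>

lemma exists_neighbour: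
  assumes u: "(a, b, x) \<in> forms m"
  shows "\<exists>w \<in> forms m. sim p (a, b, x) w \<and> (residual p w \<longleftrightarrow> residual p (a, b, x))"
proof -
  have m: "m = 8 * a * b - x\<^sup>2"
    using u unfolding forms_def by auto
  have pp: "p > 0" using p_gt_2 by simp
  show ?thesis
  proof (cases "p dvd b")
    case False
    then have "coprime (4 * b) p"
      using p_not_dvd_4 prime_p prime_dvd_mult_iff
      by (metis coprime_commute prime_imp_coprime_int)
    then obtain z where z: "[4 * b * z = 1] (mod p)"
      using cong_solve_coprime_int by blast
    \<comment> \<open>The double root modulo p: (1, \<gamma>) annihilates the derivative x + 4 b
      \<gamma>, and hence the form itself.\<close>
    define \<gamma> where "\<gamma> = - x * z"
    have "p dvd x * (1 - 4 * b * z)"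
      using z by (simp add: cong_iff_dvd_diff dvd_diff_commute)
    then have "p dvd x + 4 * b * \<gamma>"
      unfolding \<gamma>_def by (simp add: algebra_simps)
    then obtain y where y: "x + 4 * b * \<gamma> = p * y" by blast
    have "8 * (b * (a + x * \<gamma> + 2 * b * \<gamma>\<^sup>2)) = (x + 4 * b * \<gamma>)\<^sup>2 + m"
      unfolding m by (simp add: algebra_simps power2_eq_square)
    then have "p dvd 8 * (b * (a + x * \<gamma> + 2 * b * \<gamma>\<^sup>2))"
      unfolding y m_eq by (simp add: power2_eq_square)
    then have "p dvd a + x * \<gamma> + 2 * b * \<gamma>\<^sup>2"
      using False p_not_dvd_8 prime_dvd_mult_iff[OF prime_p] by blast
    then obtain a' where a': "a + x * \<gamma> + 2 * b * \<gamma>\<^sup>2 = p * a'" by blast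
    have yy: "p * (p * y) = p * x + 4 * (p * (b * \<gamma>))"
      unfolding y[symmetric] by (simp add: algebra_simps)
    have s: "sim p (a, b, x) (a', p * b, p * y)"
      by (rule simI[where \<alpha> = 1 and \<beta> = 0 and \<gamma> = \<gamma> and \<delta> = p])
        (use pp a' yy in \<open>simp_all add: algebra_simps power2_eq_square\<close>)
    have w: "(a', p * b, p * y) \<in> forms m"
      by (rule sim_forms[OF s pp u m_pos])
    have na: "\<not> p dvd a'"
      using forms_not_both_dvd[OF w] by simp
    have "p * m' = p * (8 * a' * b - p * y\<^sup>2)"
      using w unfolding forms_def m_eq by (auto simp: algebra_simps power2_eq_square)
    then have "m' = 8 * a' * b - p * y\<^sup>2" using pp by simp
    \<comment> \<open>8 a' b is congruent to the residue m', so a' and b have opposite symbols. The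
      character is read off from b for the old form and from 2 a' for the new one, so the factor 2
      restores agreement.\<close>
    then have "[m' = 2 * (4 * (a' * b))] (mod p)"
      by (simp add: cong_iff_dvd_diff)
    from Legendre_cong[OF this] have "Legendre a' p * Legendre b p = - 1"
      unfolding Lmult Lm' L2 L4 by simp
    then have "residual p (a', p * b, p * y) \<longleftrightarrow> residual p (a, b, x)"
      using residual_iff_b[OF u False] residual_iff_a[OF w na] Legendre_cases[OF False] by force
    then show ?thesis using s w by blast
  next
    case True
    then have na: "\<not> p dvd a" using forms_not_both_dvd[OF u] by blast
    have "p dvd x\<^sup>2"
    proof -
      have "x\<^sup>2 = 8 * a * b - p * m'" using m m_eq by simp
      then show ?thesis using True by simp
    qed
    then have "p dvd x" using prime_p prime_dvd_power by blast
    then obtain y where y: "x = p * y" by blast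
    obtain b' where b': "b = p * b'" using True by blast
    have s: "sim p (a, b, x) (p * a, b', x)"
      by (rule simI[where \<alpha> = p and \<beta> = 0 and \<gamma> = 0 and \<delta> = 1])
        (use pp in \<open>simp_all add: b' algebra_simps power2_eq_square\<close>)
    have w: "(p * a, b', x) \<in> forms m"
      by (rule sim_forms[OF s pp u m_pos])
    have nb: "\<not> p dvd b'"
      using forms_not_both_dvd[OF w] by simp
    have "p * m' = p * (8 * a * b' - p * y\<^sup>2)"
      using w unfolding forms_def m_eq y by (auto simp: algebra_simps power2_eq_square)
    then have "m' = 8 * a * b' - p * y\<^sup>2" using pp by simp
    then have "[m' = 2 * (4 * (a * b'))] (mod p)"
      by (simp add: cong_iff_dvd_diff)
    from Legendre_cong[OF this] have "Legendre a p * Legendre b' p = - 1"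
      unfolding Lmult Lm' L2 L4 by simp
    then have "residual p (p * a, b', x) \<longleftrightarrow> residual p (a, b, x)"
      using residual_iff_b[OF w nb] residual_iff_a[OF u na] Legendre_cases[OF nb] by force
    then show ?thesis using s w by blast
  qed
qed

text \<open>Modulo p the form is degenerate but not zero, so its isotropic vectors form a single
  line. Concretely, both partial derivatives vanish at an isotropic vector, and eliminating between
  two such vectors leaves 2 a and 4 b times their determinant.\<close>

lemma column_divides:
  assumes "(a, b, x) \<in> forms m" "p dvd a * X\<^sup>2 + x * X * Y + 2 * b * Y\<^sup>2"
    "p dvd a * Z\<^sup>2 + x * Z * T + 2 * b * T\<^sup>2"
  shows "p dvd X * T - Z * Y"
proof -
  have m: "m = 8 * a * b - x\<^sup>2"
    using assms(1) unfolding forms_def by auto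
  have *: "p dvd 2 * a * X + x * Y \<and> p dvd x * X + 4 * b * Y"
    if d: "p dvd a * X\<^sup>2 + x * X * Y + 2 * b * Y\<^sup>2" for X Y
  proof
    have "(2 * a * X + x * Y)\<^sup>2 = 4 * a * (a * X\<^sup>2 + x * X * Y + 2 * b * Y\<^sup>2) - m * Y\<^sup>2"
      unfolding m by (simp add: algebra_simps power2_eq_square)
    then have "p dvd (2 * a * X + x * Y)\<^sup>2"
      using d m_eq by simp
    then show "p dvd 2 * a * X + x * Y" using prime_p prime_dvd_power by blast
    have "(x * X + 4 * b * Y)\<^sup>2 = 8 * b * (a * X\<^sup>2 + x * X * Y + 2 * b * Y\<^sup>2) - m * X\<^sup>2"
      unfolding m by (simp add: algebra_simps power2_eq_square)
    then have "p dvd (x * X + 4 * b * Y)\<^sup>2"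
      using d m_eq by simp
    then show "p dvd x * X + 4 * b * Y" using prime_p prime_dvd_power by blast
  qed
  have "2 * (a * (X * T - Z * Y)) = (2 * a * X + x * Y) * T - (2 * a * Z + x * T) * Y"
    "4 * (b * (X * T - Z * Y)) = X * (x * Z + 4 * b * T) - Z * (x * X + 4 * b * Y)"
    by (simp_all add: algebra_simps)
  then have "p dvd 2 * (a * (X * T - Z * Y))" "p dvd 4 * (b * (X * T - Z * Y))"
    using *[OF assms(2)] *[OF assms(3)] by auto
  then show ?thesis
    using forms_not_both_dvd[OF assms(1)] p_not_dvd_2 p_not_dvd_4 prime_dvd_mult_iff[OF prime_p] by blast
qed

text \<open>If M and M' lead from \<open>u\<close> to its two neighbours, adj(M) M' / p leads from
  one to the other. It is integral because all columns of M and M' are isotropic modulo p, hence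
  pairwise proportional.\<close>

lemma neighbour_unique:
  assumes "u \<in> forms m" "sim p u w" "sim p u z"
  shows "sim 1 w z"
proof -
  have pp: "p > 0" using p_gt_2 by simp
  obtain a b x where u: "u = (a, b, x)" by (cases u) auto
  obtain a' b' x' where w: "w = (a', b', x')" by (cases w) auto
  obtain a2 b2 x2 where z: "z = (a2, b2, x2)" by (cases z) auto
  obtain \<alpha> \<beta> \<gamma> \<delta> where M: "\<bar>\<alpha> * \<delta> - 2 * \<beta> * \<gamma>\<bar> = p"
    and e: "p * a' = a * \<alpha>\<^sup>2 + x * \<alpha> * \<gamma> + 2 * b * \<gamma>\<^sup>2"
    "p * b' = 2 * a * \<beta>\<^sup>2 + x * \<beta> * \<delta> + b * \<delta>\<^sup>2"
    "p * x' = 4 * a * \<alpha> * \<beta> + x * (\<alpha> * \<delta> + 2 * \<beta> * \<gamma>) + 4 * b * \<gamma> * \<delta>"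
    using assms(2) unfolding u w by (rule simE)
  obtain A B C D where M': "\<bar>A * D - 2 * B * C\<bar> = p"
    and e': "p * a2 = a * A\<^sup>2 + x * A * C + 2 * b * C\<^sup>2"
    "p * b2 = 2 * a * B\<^sup>2 + x * B * D + b * D\<^sup>2"
    "p * x2 = 4 * a * A * B + x * (A * D + 2 * B * C) + 4 * b * C * D"
    using assms(3) unfolding u z by (rule simE)
  note uu = assms(1)[unfolded u]
  have c: "p dvd a * \<alpha>\<^sup>2 + x * \<alpha> * \<gamma> + 2 * b * \<gamma>\<^sup>2" "p dvd a * A\<^sup>2 + x * A * C + 2 * b * C\<^sup>2"
    unfolding e(1)[symmetric] e'(1)[symmetric] by simp_all
  have "a * (2 * \<beta>)\<^sup>2 + x * (2 * \<beta>) * \<delta> + 2 * b * \<delta>\<^sup>2 = p * (2 * b')"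
    "a * (2 * B)\<^sup>2 + x * (2 * B) * D + 2 * b * D\<^sup>2 = p * (2 * b2)"
    using e(2) e'(2) by (simp_all add: algebra_simps power2_eq_square)
  then have c': "p dvd a * (2 * \<beta>)\<^sup>2 + x * (2 * \<beta>) * \<delta> + 2 * b * \<delta>\<^sup>2"
    "p dvd a * (2 * B)\<^sup>2 + x * (2 * B) * D + 2 * b * D\<^sup>2"
    by simp_all
  have "p dvd \<delta> * A - 2 * \<beta> * C"
    using column_divides[OF uu c(2) c'(1)] by (simp add: mult_ac)
  then obtain k1 where k1: "\<delta> * A - 2 * \<beta> * C = p * k1" by blast
  have "p dvd \<alpha> * C - \<gamma> * A"
    using column_divides[OF uu c(1) c(2)] by (simp add: mult_ac)
  then obtain k3 where k3: "\<alpha> * C - \<gamma> * A = p * k3" by blast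
  have "p dvd \<alpha> * D - 2 * \<gamma> * B"
    using column_divides[OF uu c(1) c'(2)] by (simp add: mult_ac)
  then obtain k4 where k4: "\<alpha> * D - 2 * \<gamma> * B = p * k4" by blast
  \<comment> \<open>The upper right entry must stay even after division by p; this works since p is
    odd.\<close>
  have "p dvd 2 * B * \<delta> - 2 * \<beta> * D"
    using column_divides[OF uu c'(2) c'(1)] by simp
  moreover have "2 * B * \<delta> - 2 * \<beta> * D = 2 * (\<delta> * B - \<beta> * D)"
    by (simp add: algebra_simps)
  ultimately have "p dvd \<delta> * B - \<beta> * D"
    using p_not_dvd_2 prime_dvd_mult_iff[OF prime_p] by metis
  then obtain k2 where k2: "\<delta> * B - \<beta> * D = p * k2" by blast
  have d2: "(\<alpha> * \<delta> - 2 * \<beta> * \<gamma>)\<^sup>2 = p\<^sup>2"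
    using M by (metis power2_abs)
  have p3: "p * (p * (p * s)) = p * (p * (p * t)) \<Longrightarrow> s = t" for s t
    using pp by simp
  show ?thesis
    unfolding w z
  proof (rule simI[where \<alpha> = k1 and \<beta> = k2 and \<gamma> = k3 and \<delta> = k4])
    have "p\<^sup>2 * (k1 * k4 - 2 * k2 * k3) = (p * k1) * (p * k4) - 2 * (p * k2) * (p * k3)"
      by (simp add: algebra_simps power2_eq_square)
    also have "\<dots> = (\<alpha> * \<delta> - 2 * \<beta> * \<gamma>) * (A * D - 2 * B * C)"
      unfolding k1[symmetric] k2[symmetric] k3[symmetric] k4[symmetric] by (simp add: algebra_simps)
    finally have "p\<^sup>2 * \<bar>k1 * k4 - 2 * k2 * k3\<bar> = p\<^sup>2"
      using M M' pp by (metis abs_mult abs_power2 power2_eq_square)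
    then show "\<bar>k1 * k4 - 2 * k2 * k3\<bar> = 1"
      using pp by simp
  next
    have "p * (p * (p * (a' * k1\<^sup>2 + x' * k1 * k3 + 2 * b' * k3\<^sup>2)))
      = (p * a') * (p * k1)\<^sup>2 + (p * x') * (p * k1) * (p * k3) + 2 * (p * b') * (p * k3)\<^sup>2"
      by (simp add: algebra_simps power2_eq_square)
    also have "\<dots> = (\<alpha> * \<delta> - 2 * \<beta> * \<gamma>)\<^sup>2 * (a * A\<^sup>2 + x * A * C + 2 * b * C\<^sup>2)"
      unfolding k1[symmetric] k3[symmetric] e by (simp add: algebra_simps power2_eq_square)
    also have "\<dots> = p * (p * (p * (1 * a2)))"
      unfolding d2 e'(1)[symmetric] by (simp add: power2_eq_square)
    finally show "1 * a2 = a' * k1\<^sup>2 + x' * k1 * k3 + 2 * b' * k3\<^sup>2"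
      by (rule p3[symmetric])
  next
    have "p * (p * (p * (2 * a' * k2\<^sup>2 + x' * k2 * k4 + b' * k4\<^sup>2)))
      = 2 * (p * a') * (p * k2)\<^sup>2 + (p * x') * (p * k2) * (p * k4) + (p * b') * (p * k4)\<^sup>2"
      by (simp add: algebra_simps power2_eq_square)
    also have "\<dots> = (\<alpha> * \<delta> - 2 * \<beta> * \<gamma>)\<^sup>2 * (2 * a * B\<^sup>2 + x * B * D + b * D\<^sup>2)"
      unfolding k2[symmetric] k4[symmetric] e by (simp add: algebra_simps power2_eq_square)
    also have "\<dots> = p * (p * (p * (1 * b2)))"
      unfolding d2 e'(2)[symmetric] by (simp add: power2_eq_square)
    finally show "1 * b2 = 2 * a' * k2\<^sup>2 + x' * k2 * k4 + b' * k4\<^sup>2"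
      by (rule p3[symmetric])
  next
    have "p * (p * (p * (4 * a' * k1 * k2 + x' * (k1 * k4 + 2 * k2 * k3) + 4 * b' * k3 * k4)))
      = 4 * (p * a') * (p * k1) * (p * k2) + (p * x') * ((p * k1) * (p * k4) + 2 * (p * k2) * (p * k3))
        + 4 * (p * b') * (p * k3) * (p * k4)"
      by (simp add: algebra_simps power2_eq_square)
    also have "\<dots> = (\<alpha> * \<delta> - 2 * \<beta> * \<gamma>)\<^sup>2 * (4 * a * A * B + x * (A * D + 2 * B * C) + 4 * b * C * D)"
      unfolding k1[symmetric] k2[symmetric] k3[symmetric] k4[symmetric] e
      by (simp add: algebra_simps power2_eq_square)
    also have "\<dots> = p * (p * (p * (1 * x2)))"
      unfolding d2 e'(3)[symmetric] by (simp add: power2_eq_square)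
    finally show "1 * x2 = 4 * a' * k1 * k2 + x' * (k1 * k4 + 2 * k2 * k3) + 4 * b' * k3 * k4"
      by (rule p3[symmetric])
  qed
qed

text \<open>
  A similitude of the form with factor \<open>p\<close> has determinant \<open>\<plusminus>p\<close>; modulo 4 only \<open>+p\<close> is possible. It
  then has trace \<open>t\<close> divisible by \<open>p\<close>, and \<open>a\<^sup>2 (4 p - t\<^sup>2) = m \<gamma>\<^sup>2\<close> forces \<open>m / p\<close> to be a square.
\<close>
lemma not_self_neighbour:
  assumes "u \<in> forms m" "sim p u u"
  shows False
proof -
  have pp: "p > 0" using p_gt_2 by simp
  obtain a b x where u: "u = (a, b, x)" by (cases u) auto
  obtain \<alpha> \<beta> \<gamma> \<delta> where M: "\<bar>\<alpha> * \<delta> - 2 * \<beta> * \<gamma>\<bar> = p"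
    and e: "p * a = a * \<alpha>\<^sup>2 + x * \<alpha> * \<gamma> + 2 * b * \<gamma>\<^sup>2"
    "p * b = 2 * a * \<beta>\<^sup>2 + x * \<beta> * \<delta> + b * \<delta>\<^sup>2"
    "p * x = 4 * a * \<alpha> * \<beta> + x * (\<alpha> * \<delta> + 2 * \<beta> * \<gamma>) + 4 * b * \<gamma> * \<delta>"
    using assms(2) unfolding u by (rule simE)
  have ab: "a > 0" "b > 0" and m: "m = 8 * a * b - x\<^sup>2"
    using assms(1) unfolding u forms_def by auto
  have "odd x"
    using odd_m unfolding m by simp
  have D: "\<alpha> * \<delta> - 2 * \<beta> * \<gamma> = p"
  proof (rule ccontr)
    assume "\<not> ?thesis"
    then have "\<alpha> * \<delta> = 2 * \<beta> * \<gamma> - p"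
      using M by linarith
    from e(3)[unfolded this]
    have "2 * (p * x) = 4 * (a * \<alpha> * \<beta> + x * \<beta> * \<gamma> + b * \<gamma> * \<delta>)"
      by (simp add: algebra_simps)
    then have "p * x = 2 * (a * \<alpha> * \<beta> + x * \<beta> * \<gamma> + b * \<gamma> * \<delta>)"
      by simp
    then have "even (p * x)" by simp
    then show False using odd_p \<open>odd x\<close> by simp
  qed
  \<comment> \<open>For the Gram matrix Q and determinant p, invariance of the form amounts to Q M =
    adj(M)^T Q. The two diagonal entries of this equation are the linear relations 1 and 2.\<close>
  have "p * (2 * a * \<alpha> + x * \<gamma>) = 2 * \<delta> * (p * a) - \<gamma> * (p * x)"
    unfolding e unfolding D[symmetric] by (simp add: algebra_simps power2_eq_square)
  also have "\<dots> = p * (2 * a * \<delta> - x * \<gamma>)"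
    by (simp add: algebra_simps)
  finally have "2 * a * \<alpha> + x * \<gamma> = 2 * a * \<delta> - x * \<gamma>"
    using pp by simp
  then have 1: "a * (\<delta> - \<alpha>) = x * \<gamma>"
    by (simp add: algebra_simps)
  have "p * (2 * x * \<beta> + 4 * b * \<delta>) = 4 * \<alpha> * (p * b) - 2 * \<beta> * (p * x)"
    unfolding e unfolding D[symmetric] by (simp add: algebra_simps power2_eq_square)
  also have "\<dots> = p * (4 * b * \<alpha> - 2 * x * \<beta>)"
    by (simp add: algebra_simps)
  finally have "2 * x * \<beta> + 4 * b * \<delta> = 4 * b * \<alpha> - 2 * x * \<beta>"
    using pp by simp
  then have 2: "b * (\<delta> - \<alpha>) = - (x * \<beta>)"
    by (simp add: algebra_simps)
  have "x * (a * \<beta>) = - (a * (b * (\<delta> - \<alpha>)))"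
    unfolding 2 by simp
  also have "\<dots> = - (b * (a * (\<delta> - \<alpha>)))"
    by (simp add: algebra_simps)
  also have "\<dots> = x * (- (b * \<gamma>))"
    unfolding 1 by simp
  finally have 3: "a * \<beta> = - (b * \<gamma>)"
    using \<open>odd x\<close> by (subst (asm) mult_cancel_left) auto
  define t where "t = \<alpha> + \<delta>"
  have tt: "4 * p - t\<^sup>2 = - (\<delta> - \<alpha>)\<^sup>2 - 8 * (\<beta> * \<gamma>)"
    unfolding t_def D[symmetric] by (simp add: algebra_simps power2_eq_square)
  have "a\<^sup>2 * (4 * p - t\<^sup>2) = - (a * (\<delta> - \<alpha>))\<^sup>2 - 8 * a * (a * \<beta>) * \<gamma>"
    unfolding tt by (simp add: algebra_simps power2_eq_square)
  then have A: "a\<^sup>2 * (4 * p - t\<^sup>2) = m * \<gamma>\<^sup>2"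
    unfolding 1 3 m by (simp add: algebra_simps power2_eq_square)
  have "b\<^sup>2 * (4 * p - t\<^sup>2) = - (b * (\<delta> - \<alpha>))\<^sup>2 + 8 * b * - (b * \<gamma>) * \<beta>"
    unfolding tt by (simp add: algebra_simps power2_eq_square)
  then have B: "b\<^sup>2 * (4 * p - t\<^sup>2) = m * \<beta>\<^sup>2"
    unfolding 2 3[symmetric] m by (simp add: algebra_simps power2_eq_square)
  have "p dvd a\<^sup>2 * (4 * p - t\<^sup>2)" "p dvd b\<^sup>2 * (4 * p - t\<^sup>2)"
    unfolding A B m_eq by simp_all
  then have "p dvd 4 * p - t\<^sup>2"
    using forms_not_both_dvd[OF assms(1)[unfolded u]] prime_dvd_mult_iff[OF prime_p] prime_dvd_power[OF prime_p] by blast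
  moreover have "t\<^sup>2 = p * 4 - (4 * p - t\<^sup>2)" by simp
  ultimately have "p dvd t\<^sup>2" by (metis dvd_diff dvd_triv_left)
  then have "p dvd t" using prime_p prime_dvd_power by blast
  then obtain s where s: "t = p * s" by blast
  have "p * (a\<^sup>2 * (4 - p * s\<^sup>2)) = p * (m' * \<gamma>\<^sup>2)"
    using A unfolding s m_eq by (simp add: algebra_simps power2_eq_square)
  then have A': "a\<^sup>2 * (4 - p * s\<^sup>2) = m' * \<gamma>\<^sup>2" using pp by simp
  have m'_pos: "m' > 0" using m_pos pp unfolding m_eq by (simp add: zero_less_mult_iff)
  have "0 \<le> a\<^sup>2 * (4 - p * s\<^sup>2)"
    unfolding A' using m'_pos by simp
  then have le: "p * s\<^sup>2 \<le> 4"
    using ab(1) by (simp add: zero_le_mult_iff)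
  have "\<bar>s\<bar> \<le> 1"
  proof (rule ccontr)
    assume "\<not> \<bar>s\<bar> \<le> 1"
    then have "2\<^sup>2 \<le> \<bar>s\<bar>\<^sup>2" by (intro power_mono) auto
    then have "3 * 4 \<le> p * s\<^sup>2" using p_gt_2 by (intro mult_mono) auto
    then show False using le by simp
  qed
  moreover have "p = 3 \<and> s\<^sup>2 = 1" if "\<bar>s\<bar> = 1"
  proof -
    have "s\<^sup>2 = 1" using that by (metis one_power2 power2_abs)
    then show ?thesis using le p_gt_2 odd_p by (cases "p = 4") auto
  qed
  \<comment> \<open>Either s = 0, or p = 3 and s = +-1; in both cases the factor is a square, so m'
    is one too.\<close>
  ultimately have "4 - p * s\<^sup>2 = 2\<^sup>2 \<or> 4 - p * s\<^sup>2 = 1\<^sup>2"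
    by (cases "s = 0") auto
  then obtain r where r: "4 - p * s\<^sup>2 = r\<^sup>2" "r > 0"
    using that[of 1] that[of 2] by auto
  have ra: "(a * r)\<^sup>2 = m' * \<gamma>\<^sup>2"
    using A' r(1) by (simp add: power_mult_distrib)
  then have "\<gamma> \<noteq> 0" using ab r by auto
  have "\<gamma>\<^sup>2 dvd (a * r)\<^sup>2" unfolding ra by simp
  then have "\<gamma> dvd a * r" by simp
  then obtain c where c: "a * r = \<gamma> * c" by blast
  then have "m' = c\<^sup>2"
    using ra \<open>\<gamma> \<noteq> 0\<close> by (simp add: power_mult_distrib)
  moreover from this have "odd c" using odd_m unfolding m_eq by simp
  ultimately have "m' mod 8 = 1" by (simp add: odd_square_mod_8)
  then have "m mod 8 = p mod 8"
    unfolding m_eq by (metis mod_mult_right_eq mult.right_neutral)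
  then show False using m7 p7 by simp
qed

text \<open>Passing to the reduced representative of a neighbour is an involution: \<open>u\<close>
  and \<open>h (h u)\<close> are both neighbours of \<open>h u\<close>, hence equivalent, hence
  equal.\<close>

lemma even_residual_reduced: "even (card {u \<in> reduced m. residual p u})"
proof -
  have pp: "p > 0" using p_gt_2 by simp
  let ?S = "{u \<in> reduced m. residual p u}"
  have ex: "\<exists>w. w \<in> ?S \<and> sim p u w" if u: "u \<in> ?S" for u
  proof -
    have "u \<in> forms m" using u reduced_subset by blast
    then obtain w where w: "w \<in> forms m" "sim p u w" "residual p w \<longleftrightarrow> residual p u"
      using exists_neighbour by (metis prod_cases3)
    obtain z where z: "z \<in> reduced m" "sim 1 w z"
      using sim_reduce[OF m_pos odd_m w(1)] by blast
    have "residual p z"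
      using sim_residual[OF sim_sym[OF z(2)]] w(3) u by simp
    moreover have "sim p u z"
      using sim_trans[OF w(2) z(2)] by simp
    ultimately show ?thesis using z by blast
  qed
  define h where "h u = (SOME w. w \<in> ?S \<and> sim p u w)" for u
  have h: "h u \<in> ?S \<and> sim p u (h u)" if "u \<in> ?S" for u
    unfolding h_def using someI_ex[OF ex[OF that]] by simp
  show ?thesis
  proof (rule even_card_involution)
    fix u assume u: "u \<in> ?S"
    show hu: "h u \<in> ?S" using h[OF u] by blast
    have up: "u \<in> forms m" "h u \<in> forms m" using u hu reduced_subset by blast+
    show "h u \<noteq> u" using not_self_neighbour[OF up(1)] h[OF u] by auto
    have "sim p (h u) u" using h[OF u] sim_sym pp by blast
    moreover have "sim p (h u) (h (h u))" using h[OF hu] by blast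
    ultimately have "sim 1 (h (h u)) u" using neighbour_unique[OF up(2)] by blast
    then show "h (h u) = u"
      using sim_reduced_unique h[OF hu] u by blast
  qed
qed

text \<open>A form (a, a, x) is fixed by the swap, which negates \<open>residual\<close>.\<close>

lemma no_diagonal_solution:
  assumes "a > 0"
  shows "8 * a\<^sup>2 - x\<^sup>2 \<noteq> m"
proof
  assume "8 * a\<^sup>2 - x\<^sup>2 = m"
  then have "(a, a, x) \<in> forms m"
    using assms unfolding forms_def by (simp add: power2_eq_square mult.assoc)
  then show False using residual_swap by blast
qed

text \<open>Each swap pair of reduced forms has exactly one member with a < b and exactly one
  residual member.\<close>

lemma even_card_ordered:
  "even (card {(a, b, x). 0 < x \<and> x < 2 * a \<and> a < b \<and> 8 * a * b - x\<^sup>2 = m})"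
    (is "even (card ?S)")
proof -
  define sw :: "int \<times> int \<times> int \<Rightarrow> int \<times> int \<times> int" where "sw = (\<lambda>(a, b, x). (b, a, x))"
  let ?G = "{u \<in> reduced m. residual p u}"
  define f where "f u = (if residual p u then u else sw u)" for u
  define g where "g u = (if fst u < fst (snd u) then u else sw u)" for u :: "int \<times> int \<times> int"
  have sub: "?S \<subseteq> forms m" by (auto simp: forms_def)
  have ne: "a \<noteq> b" if "(a, b, x) \<in> forms m" for a b x
    using residual_swap[OF that] by auto
  have "bij_betw f ?S ?G"
  proof (rule bij_betw_byWitness[where f' = g])
    show "\<forall>u \<in> ?S. g (f u) = u"
      by (auto simp: f_def g_def sw_def)
    show "\<forall>u \<in> ?G. f (g u) = u"
    proof safe
      fix a b x assume r: "(a, b, x) \<in> reduced m" and gd: "residual p (a, b, x)"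
      show "f (g (a, b, x)) = (a, b, x)"
        using residual_swap[of a b x] r reduced_subset gd by (auto simp: f_def g_def sw_def)
    qed
    show "f ` ?S \<subseteq> ?G"
    proof (rule image_subsetI)
      fix u assume u: "u \<in> ?S"
      obtain a b x where ux: "u = (a, b, x)" by (cases u) auto
      have "(a, b, x) \<in> forms m" using u sub ux by blast
      then show "f u \<in> ?G"
        using residual_swap[of a b x] u unfolding ux by (auto simp: f_def sw_def reduced_def mult_ac)
    qed
    show "g ` ?G \<subseteq> ?S"
    proof (rule image_subsetI)
      fix u assume u: "u \<in> ?G"
      obtain a b x where ux: "u = (a, b, x)" by (cases u) auto
      have "a \<noteq> b" using ne u reduced_subset unfolding ux by blast
      then show "g u \<in> ?S"
        using u unfolding ux by (auto simp: g_def sw_def reduced_def mult_ac)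
    qed
  qed
  then show ?thesis
    using even_residual_reduced bij_betw_same_card[of f ?S ?G] by simp
qed

end

section \<open>The Bailey pair\<close>

abbreviation q :: "int fps" where "q \<equiv> fps_X"

lemma power_double:
  fixes x :: "'a :: monoid_mult"
  shows "x ^ (2 * n) = x ^ n * x ^ n" "x ^ (n * 2) = x ^ n * x ^ n"
  by (simp_all add: mult_2 mult_2_right power_add)

definition geo :: "nat \<Rightarrow> int fps" where
  "geo j = Abs_fps (\<lambda>n. if j dvd n then 1 else 0)"

lemma geo_inverse:
  assumes "j > 0"
  shows "(1 - q ^ j) * geo j = 1"
proof (rule fps_ext)
  fix n
  show "fps_nth ((1 - q ^ j) * geo j) n = fps_nth 1 n"
    using assms by (cases "n < j") (auto simp: left_diff_distrib fps_X_power_mult_nth geo_def dvd_minus_self dest: dvd_imp_le)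
qed

definition qfac :: "nat \<Rightarrow> int fps" where
  "qfac n = (\<Prod>j=1..n. 1 - q ^ j)"

definition iqfac :: "nat \<Rightarrow> int fps" where
  "iqfac n = (\<Prod>j=1..n. geo j)"

definition iqodd :: "nat \<Rightarrow> int fps" where
  "iqodd n = (\<Prod>i<n. geo (2 * i + 1))"

text \<open>The factor 1/(q)_{N-k} with the usual convention that it vanishes for k > N, where
  truncated subtraction alone would give 1.\<close>

definition pm :: "nat \<Rightarrow> nat \<Rightarrow> int fps" where
  "pm N k = (if k \<le> N then iqfac (N - k) else 0)"

lemma qfac_simps [simp]: "qfac 0 = 1" "qfac (Suc n) = qfac n * (1 - q ^ Suc n)"
  by (simp_all add: qfac_def)

lemma iqfac_0 [simp]: "iqfac 0 = 1"
  by (simp add: iqfac_def)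

lemma iqfac_Suc: "iqfac n = (1 - q ^ Suc n) * iqfac (Suc n)"
proof -
  have "(1 - q ^ Suc n) * iqfac (Suc n) = ((1 - q ^ Suc n) * geo (Suc n)) * iqfac n"
    by (simp add: iqfac_def mult_ac)
  then show ?thesis
    unfolding geo_inverse[OF zero_less_Suc] by simp
qed

lemma qfac_iqfac: "qfac n * iqfac n = 1"
proof (induction n)
  case (Suc n)
  have "qfac (Suc n) * iqfac (Suc n) = qfac n * ((1 - q ^ Suc n) * iqfac (Suc n))"
    by (simp add: mult_ac)
  then show ?case
    using Suc unfolding iqfac_Suc[of n] by (simp add: mult.assoc)
qed simp

lemma pm_Suc_left: "k \<le> Suc N \<Longrightarrow> pm N k = (1 - q ^ (Suc N - k)) * pm (Suc N) k"
  using iqfac_Suc[of "N - k"] by (cases "k = Suc N") (auto simp: pm_def Suc_diff_le)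

lemma pm_Suc_right: "k \<le> N \<Longrightarrow> pm N (Suc k) = (1 - q ^ (N - k)) * pm N k"
  using iqfac_Suc[of "N - Suc k"] by (cases "k = N") (auto simp: pm_def Suc_diff_Suc)

definition tri :: "nat \<Rightarrow> nat" where
  "tri k = k * (k + 1) div 2"

lemma tri_simps [simp]: "tri 0 = 0" "tri (Suc k) = tri k + Suc k"
  by (simp_all add: tri_def)

text \<open>\<open>hecke k\<close> is the sum of \<open>q\<close> to the power \<open>k (k - 1) - tri j\<close> over \<open>j < k\<close>.\<close>
primrec hecke :: "nat \<Rightarrow> int fps" where
  "hecke 0 = 0"
| "hecke (Suc k) = q ^ (2 * k) * hecke k + q ^ tri k"

text \<open>
  The sum of \<open>\<alpha>\<^sub>k / ((q)\<^bsub>N-k\<^esub> (q)\<^bsub>N+k\<^esub>)\<close> over \<open>k = i + 1\<close> for the pair with \<open>\<beta>\<close> equal to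
  \<open>iqodd N\<close>, the reciprocal of the product of the first \<open>N\<close> factors \<open>1 - q\<^bsup>2i+1\<^esup>\<close>.
\<close>
definition bailey_sum :: "nat \<Rightarrow> int fps" where
  "bailey_sum N = (\<Sum>i<N. (- 1) ^ i * (1 - q ^ (2 * i + 2)) * hecke (Suc i) * pm N (Suc i) * iqfac (N + i + 1))"

text \<open>The recurrence of \<open>hecke\<close> makes the two occurrences of each intermediate g
  i cancel, apart from the term \<open>q ^ tri i\<close>.\<close>

lemma hecke_by_parts:
  fixes g :: "nat \<Rightarrow> int fps"
  shows "(\<Sum>i<n. (- 1) ^ i * hecke (Suc i) * (g i + q ^ (2 * i + 2) * g (Suc i)))
    = (\<Sum>i<n. (- 1) ^ i * q ^ tri i * g i) - (- 1) ^ n * hecke n * q ^ (2 * n) * g n"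
  by (induction n) (simp_all add: algebra_simps)

lemma alternating_telescope:
  fixes h :: "nat \<Rightarrow> 'a :: comm_ring_1"
  shows "(\<Sum>i<n. (- 1) ^ i * (h i + h (Suc i))) = h 0 - (- 1) ^ n * h n"
  by (induction n) (simp_all add: algebra_simps)

text \<open>
  The certificate \<open>g\<close> telescopes the summand up to the factor \<open>hecke\<close>; summation by parts removes
  that factor, and the certificate \<open>h\<close> telescopes what remains.
\<close>
lemma bailey_sum_step:
  assumes "N \<ge> 1"
  shows "(1 - q ^ (2 * N + 1)) * bailey_sum (Suc N) = bailey_sum N"
proof -
  define g where "g i = q ^ (N - i) * (1 - q ^ (2 * i + 1)) * pm (Suc N) (Suc i) * iqfac (Suc N + i)" for i
  define h where "h i = q ^ tri i * q ^ (N - i) * (1 - q ^ i) * pm (Suc N) (Suc i) * iqfac (N + i)" for i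
  have g: "(1 - q ^ (2 * i + 2)) * ((1 - q ^ (2 * N + 1)) * pm (Suc N) (Suc i) * iqfac (N + i + 2)
      - pm N (Suc i) * iqfac (N + i + 1)) = g i + q ^ (2 * i + 2) * g (Suc i)" if i: "i \<le> N" for i
  proof -
    obtain l where N: "N = i + l" using i le_Suc_ex by blast
    have e: "Suc (N + i + 1) = N + i + 2" "N + i + 2 = l + 2 * i + 2" "Suc N - Suc i = l"
      by (simp_all add: N)
    have p: "pm N (Suc i) = (1 - q ^ l) * pm (Suc N) (Suc i)"
      using pm_Suc_left[of "Suc i" N] i unfolding e by simp
    have p': "iqfac (N + i + 1) = (1 - q ^ (l + 2 * i + 2)) * iqfac (N + i + 2)"
      using iqfac_Suc[of "N + i + 1"] unfolding e(1) e(2)[symmetric] .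
    have g0: "g i = q ^ l * (1 - q ^ (2 * i + 1)) * pm (Suc N) (Suc i) * iqfac (N + i + 1)"
      unfolding g_def using e by simp
    show ?thesis
    \<comment> \<open>At i = N the exponent \<open>N - Suc i\<close> is truncated, but
      \<open>pm\<close> annihilates that term.\<close>
    proof (cases l)
      case 0
      then have "g (Suc i) = 0" by (simp add: g_def pm_def N)
      then show ?thesis
        unfolding g0 p p' by (simp add: N 0 algebra_simps power_add power_double power2_eq_square)
    next
      case (Suc l')
      have "pm (Suc N) (Suc (Suc i)) = (1 - q ^ l) * pm (Suc N) (Suc i)"
        using pm_Suc_right[of "Suc i" "Suc N"] by (simp add: N)
      then have g1: "g (Suc i) = q ^ l' * (1 - q ^ (2 * i + 3)) * ((1 - q ^ l) * pm (Suc N) (Suc i)) * iqfac (N + i + 2)"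
        unfolding g_def by (simp add: N Suc numeral_3_eq_3)
      show ?thesis
        unfolding g0 g1 p p' by (simp add: N Suc algebra_simps power_add power_double power2_eq_square eval_nat_numeral)
    qed
  qed
  have h: "(1 - q ^ N) * (q ^ tri i * g i) = h i + h (Suc i)" if i: "i \<le> N" for i
  proof -
    obtain l where N: "N = i + l" using i le_Suc_ex by blast
    have e: "Suc (N + i) = Suc N + i" "Suc N + i = l + 2 * i + 1"
      by (simp_all add: N)
    have p: "iqfac (N + i) = (1 - q ^ (l + 2 * i + 1)) * iqfac (Suc N + i)"
      using iqfac_Suc[of "N + i"] unfolding e(1) e(2)[symmetric] .
    have h0: "h i = q ^ tri i * q ^ l * (1 - q ^ i) * pm (Suc N) (Suc i) * iqfac (N + i)"
      "g i = q ^ l * (1 - q ^ (2 * i + 1)) * pm (Suc N) (Suc i) * iqfac (Suc N + i)"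
      unfolding g_def h_def by (simp_all add: N)
    show ?thesis
    proof (cases l)
      case 0
      then have "h (Suc i) = 0" by (simp add: h_def pm_def N)
      then show ?thesis
        unfolding h0 p by (simp add: N 0 algebra_simps power_add power_double power2_eq_square)
    next
      case (Suc l')
      have "pm (Suc N) (Suc (Suc i)) = (1 - q ^ l) * pm (Suc N) (Suc i)"
        using pm_Suc_right[of "Suc i" "Suc N"] by (simp add: N)
      then have h1: "h (Suc i) = q ^ (tri i + Suc i) * q ^ l' * (1 - q ^ Suc i) * ((1 - q ^ l) * pm (Suc N) (Suc i)) * iqfac (Suc N + i)"
        unfolding h_def by (simp add: N Suc)
      show ?thesis
        unfolding h0 h1 p by (simp add: N Suc algebra_simps power_add power_double power2_eq_square)
    qed
  qed
  define D where "D = (\<Sum>i<Suc N. (- 1) ^ i * q ^ tri i * g i)"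
  have "(1 - q ^ N) * D = (\<Sum>i<Suc N. (- 1) ^ i * ((1 - q ^ N) * (q ^ tri i * g i)))"
    unfolding D_def sum_distrib_left by (intro sum.cong) (simp_all add: mult_ac)
  also have "\<dots> = (\<Sum>i<Suc N. (- 1) ^ i * (h i + h (Suc i)))"
    by (intro sum.cong) (simp_all add: h)
  also have "\<dots> = h 0 - (- 1) ^ Suc N * h (Suc N)"
    by (rule alternating_telescope)
  \<comment> \<open>h 0 vanishes through the factor 1 - q^0, and h (Suc N) through
    \<open>pm\<close>.\<close>
  also have "\<dots> = 0"
    by (simp add: h_def pm_def)
  finally have "geo N * ((1 - q ^ N) * D) = 0" by simp
  then have D: "D = 0"
    using geo_inverse[of N] assms by (metis less_le_trans mult.assoc mult.commute mult_1 zero_less_one)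
  have "bailey_sum N = (\<Sum>i<Suc N. (- 1) ^ i * (1 - q ^ (2 * i + 2)) * hecke (Suc i) * pm N (Suc i) * iqfac (N + i + 1))"
    by (simp add: bailey_sum_def pm_def)
  then have "(1 - q ^ (2 * N + 1)) * bailey_sum (Suc N) - bailey_sum N
    = (\<Sum>i<Suc N. (- 1) ^ i * hecke (Suc i) * ((1 - q ^ (2 * i + 2)) *
        ((1 - q ^ (2 * N + 1)) * pm (Suc N) (Suc i) * iqfac (N + i + 2) - pm N (Suc i) * iqfac (N + i + 1))))"
    unfolding bailey_sum_def[of "Suc N"] sum_distrib_left
    by (simp only: sum_subtractf[symmetric]) (intro sum.cong refl, simp add: algebra_simps)
  also have "\<dots> = (\<Sum>i<Suc N. (- 1) ^ i * hecke (Suc i) * (g i + q ^ (2 * i + 2) * g (Suc i)))"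
    by (intro sum.cong refl) (simp only: g lessThan_Suc_atMost atMost_iff)
  also have "\<dots> = D - (- 1) ^ Suc N * hecke (Suc N) * q ^ (2 * Suc N) * g (Suc N)"
    unfolding D_def by (rule hecke_by_parts)
  also have "\<dots> = 0"
    unfolding D by (simp add: g_def pm_def)
  finally show ?thesis by simp
qed

text \<open>The recursion starts at 1, since \<open>bailey_sum 0\<close> is an empty sum whereas
  \<open>iqodd 0\<close> is 1.\<close>

lemma bailey_sum_eq: "bailey_sum (Suc N) = iqodd (Suc N)"
proof (induction N)
  case 0
  have "bailey_sum 1 = (1 - q\<^sup>2) * geo 2 * geo 1"
    by (simp add: bailey_sum_def pm_def iqfac_def numeral_2_eq_2)
  then show ?case
    using geo_inverse[of 2] by (simp add: iqodd_def)
next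
  case (Suc N)
  let ?m = "2 * Suc N + 1"
  have "bailey_sum (Suc (Suc N)) = ((1 - q ^ ?m) * geo ?m) * bailey_sum (Suc (Suc N))"
    by (subst geo_inverse) simp_all
  also have "\<dots> = geo ?m * ((1 - q ^ ?m) * bailey_sum (Suc (Suc N)))"
    by (simp only: mult_ac)
  also have "\<dots> = geo ?m * iqodd (Suc N)"
    using bailey_sum_step[of "Suc N"] Suc by simp
  also have "\<dots> = iqodd (Suc (Suc N))"
    by (simp add: iqodd_def mult_ac)
  finally show ?case .
qed

text \<open>
  Bailey's lemma with both parameters equal to \<open>q\<close>: the partial sums over \<open>M < N\<close> are known in closed
  form, and their defect from the limit is this factor, which tends to 1.
\<close>
definition tail_factor :: "nat \<Rightarrow> nat \<Rightarrow> int fps" where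
  "tail_factor N k = (qfac N)\<^sup>2 * pm N k * iqfac (N + k)"

definition hterm :: "nat \<Rightarrow> int fps" where
  "hterm i = (- 1) ^ i * q ^ i * hecke (Suc i) * (1 + q ^ Suc i) * geo (Suc i)"

text \<open>With l = N - i, (1 - q^(N+1))^2 - (1 - q^l)(1 - q^(l+2i+2)) equals q^l (1 -
  q^(i+1))^2.\<close>

lemma tail_factor_step:
  assumes "i \<le> N"
  shows "q ^ i * (tail_factor (Suc N) (Suc i) - tail_factor N (Suc i))
    = (1 - q ^ Suc i)\<^sup>2 * ((qfac N)\<^sup>2 * q ^ N * pm (Suc N) (Suc i) * iqfac (Suc N + i + 1))"
proof -
  obtain l where N: "N = i + l" using assms le_Suc_ex by blast
  define Z where "Z = pm (Suc N) (Suc i) * iqfac (Suc N + i + 1)"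
  have e: "Suc (N + i + 1) = Suc N + i + 1" "Suc N + i + 1 = l + 2 * i + 2" "Suc N - Suc i = l"
    by (simp_all add: N)
  have p: "pm N (Suc i) = (1 - q ^ l) * pm (Suc N) (Suc i)"
    using pm_Suc_left[of "Suc i" N] assms unfolding e by simp
  have p': "iqfac (N + i + 1) = (1 - q ^ (l + 2 * i + 2)) * iqfac (Suc N + i + 1)"
    using iqfac_Suc[of "N + i + 1"] unfolding e(1) e(2)[symmetric] .
  have c: "tail_factor (Suc N) (Suc i) = (qfac N)\<^sup>2 * (1 - q ^ Suc N)\<^sup>2 * Z"
    by (simp add: tail_factor_def Z_def power_mult_distrib mult_ac)
  have c': "tail_factor N (Suc i) = (qfac N)\<^sup>2 * ((1 - q ^ l) * (1 - q ^ (l + 2 * i + 2))) * Z"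
    unfolding tail_factor_def Z_def p using p' by (simp add: mult_ac)
  have "q ^ i * ((1 - q ^ Suc N)\<^sup>2 - (1 - q ^ l) * (1 - q ^ (l + 2 * i + 2))) = (1 - q ^ Suc i)\<^sup>2 * q ^ N"
    by (simp add: N algebra_simps power_add power_double power2_eq_square)
  then have "(qfac N)\<^sup>2 * Z * (q ^ i * ((1 - q ^ Suc N)\<^sup>2 - (1 - q ^ l) * (1 - q ^ (l + 2 * i + 2))))
    = (qfac N)\<^sup>2 * Z * ((1 - q ^ Suc i)\<^sup>2 * q ^ N)"
    by (rule arg_cong)
  then show ?thesis
    unfolding c c' Z_def by (simp only: algebra_simps)
qed

text \<open>A finite Bailey lemma: raising N by one increases the right side by (q)_N^2 q^N times
  \<open>bailey_sum (Suc N)\<close>.\<close>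

lemma partial_sum_eq:
  "(\<Sum>M<N. (qfac M)\<^sup>2 * q ^ M * iqodd (Suc M)) = (\<Sum>i<N. hterm i * tail_factor N (Suc i))"
proof (induction N)
  case (Suc N)
  have "(\<Sum>i<Suc N. hterm i * tail_factor (Suc N) (Suc i)) - (\<Sum>i<N. hterm i * tail_factor N (Suc i))
    = (\<Sum>i<Suc N. hterm i * tail_factor (Suc N) (Suc i)) - (\<Sum>i<Suc N. hterm i * tail_factor N (Suc i))"
    by (simp add: tail_factor_def pm_def)
  also have "\<dots> = (\<Sum>i<Suc N. (- 1) ^ i * hecke (Suc i) * (1 + q ^ Suc i) * geo (Suc i) *
      (q ^ i * (tail_factor (Suc N) (Suc i) - tail_factor N (Suc i))))"
    unfolding sum_subtractf[symmetric] hterm_def by (intro sum.cong refl) (simp add: algebra_simps)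
  also have "\<dots> = (\<Sum>i<Suc N. ((qfac N)\<^sup>2 * q ^ N) * ((- 1) ^ i * (1 - q ^ (2 * i + 2)) * hecke (Suc i) *
      pm (Suc N) (Suc i) * iqfac (Suc N + i + 1)))"
  proof (intro sum.cong refl)
    fix i assume "i \<in> {..<Suc N}"
    then have i: "i \<le> N" by simp
    have "(1 + q ^ Suc i) * geo (Suc i) * (1 - q ^ Suc i)\<^sup>2
      = (1 + q ^ Suc i) * (1 - q ^ Suc i) * ((1 - q ^ Suc i) * geo (Suc i))"
      by (simp add: power2_eq_square mult_ac)
    also have "\<dots> = 1 - q ^ (2 * i + 2)"
      unfolding geo_inverse[OF zero_less_Suc] by (simp add: algebra_simps power_add power_double power2_eq_square)
    finally have e: "(1 + q ^ Suc i) * geo (Suc i) * (1 - q ^ Suc i)\<^sup>2 = 1 - q ^ (2 * i + 2)" .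
    have "(- 1) ^ i * hecke (Suc i) * (1 + q ^ Suc i) * geo (Suc i) * (q ^ i * (tail_factor (Suc N) (Suc i) - tail_factor N (Suc i)))
      = (- 1) ^ i * hecke (Suc i) * ((1 + q ^ Suc i) * geo (Suc i) * (1 - q ^ Suc i)\<^sup>2) *
        ((qfac N)\<^sup>2 * q ^ N * pm (Suc N) (Suc i) * iqfac (Suc N + i + 1))"
      unfolding tail_factor_step[OF i] by (simp only: mult_ac)
    then show "(- 1) ^ i * hecke (Suc i) * (1 + q ^ Suc i) * geo (Suc i) * (q ^ i * (tail_factor (Suc N) (Suc i) - tail_factor N (Suc i)))
      = ((qfac N)\<^sup>2 * q ^ N) * ((- 1) ^ i * (1 - q ^ (2 * i + 2)) * hecke (Suc i) *
      pm (Suc N) (Suc i) * iqfac (Suc N + i + 1))"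
      unfolding e by (simp only: mult_ac)
  qed
  also have "\<dots> = (qfac N)\<^sup>2 * q ^ N * bailey_sum (Suc N)"
    unfolding bailey_sum_def sum_distrib_left ..
  finally have "(\<Sum>i<Suc N. hterm i * tail_factor (Suc N) (Suc i))
    = (\<Sum>i<N. hterm i * tail_factor N (Suc i)) + (qfac N)\<^sup>2 * q ^ N * iqodd (Suc N)"
    unfolding bailey_sum_eq by (simp only: algebra_simps)
  then show ?case
    unfolding Suc.IH[symmetric] by simp
qed simp

section \<open>Passage to the limit, coefficient by coefficient\<close>

lemma qfac_dvd: "c \<le> a + 1 \<Longrightarrow> q ^ c dvd qfac (a + l) * iqfac a - 1"
proof (induction l)
  case (Suc l)
  have "qfac (a + Suc l) * iqfac a - 1 = (qfac (a + l) * iqfac a - 1) - q ^ (a + l + 1) * (qfac (a + l) * iqfac a)"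
    by (simp add: algebra_simps)
  moreover have "q ^ c dvd q ^ (a + l + 1) * (qfac (a + l) * iqfac a)"
    using Suc.prems by (intro dvd_mult2 le_imp_power_dvd) simp
  ultimately show ?case
    using Suc by (simp only: dvd_diff)
qed (simp add: qfac_iqfac)

lemma iqfac_dvd: "c \<le> a + 1 \<Longrightarrow> q ^ c dvd qfac a * iqfac (a + l) - 1"
proof (induction l)
  case (Suc l)
  have "qfac a * iqfac (a + l) = qfac a * ((1 - q ^ (a + l + 1)) * iqfac (a + Suc l))"
    using iqfac_Suc[of "a + l"] by simp
  then have "qfac a * iqfac (a + Suc l) - 1 = (qfac a * iqfac (a + l) - 1) + q ^ (a + l + 1) * (qfac a * iqfac (a + Suc l))"
    by (simp add: algebra_simps)
  moreover have "q ^ c dvd q ^ (a + l + 1) * (qfac a * iqfac (a + Suc l))"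
    using Suc.prems by (intro dvd_mult2 le_imp_power_dvd) simp
  ultimately show ?case
    using Suc by (simp only: dvd_add)
qed (simp add: qfac_iqfac)

lemma tail_factor_dvd:
  assumes "i < N"
  shows "q ^ (N - i) dvd tail_factor N (Suc i) - 1"
proof -
  let ?A = "qfac N * iqfac (N - Suc i)" and ?B = "qfac N * iqfac (N + Suc i)"
  have "q ^ (N - i) dvd ?A - 1"
    using qfac_dvd[of "N - i" "N - Suc i" "Suc i"] assms by simp
  moreover have "q ^ (N - i) dvd ?B - 1"
    by (rule iqfac_dvd) simp
  moreover have "tail_factor N (Suc i) - 1 = (?A - 1) * ?B + (?B - 1)"
    using assms by (simp add: tail_factor_def pm_def algebra_simps power2_eq_square)
  ultimately show ?thesis
    by (simp only: dvd_add dvd_mult2)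
qed

text \<open>\<open>hterm i\<close> contains q^i and the tail factor is 1 modulo q^(N-i), so dropping
  it changes only coefficients from q^N on.\<close>

lemma coeff_partial_sum:
  assumes "n < N"
  shows "fps_nth (\<Sum>M<N. (qfac M)\<^sup>2 * q ^ M * iqodd (Suc M)) n = (\<Sum>i<N. fps_nth (hterm i) n)"
proof -
  have "fps_nth (hterm i * tail_factor N (Suc i)) n = fps_nth (hterm i) n" if i: "i < N" for i
  proof -
    obtain d where d: "tail_factor N (Suc i) - 1 = q ^ (N - i) * d"
      using tail_factor_dvd[OF i] unfolding dvd_def by blast
    have "hterm i * tail_factor N (Suc i) - hterm i = hterm i * (tail_factor N (Suc i) - 1)"
      by (simp add: algebra_simps)
    also have "\<dots> = q ^ N * ((- 1) ^ i * hecke (Suc i) * (1 + q ^ Suc i) * geo (Suc i) * d)"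
      unfolding d hterm_def using i power_add[of q i "N - i"] by (simp add: mult_ac)
    finally have "fps_nth (hterm i * tail_factor N (Suc i) - hterm i) n = 0"
      using assms by (simp only: fps_X_power_mult_nth if_True)
    then show ?thesis by simp
  qed
  then show ?thesis
    unfolding partial_sum_eq by (simp add: fps_sum_nth)
qed

section \<open>Odd-balanced unimodal sequences\<close>

definition gf :: "'a set \<Rightarrow> ('a \<Rightarrow> nat) \<Rightarrow> int fps" where
  "gf S w = Abs_fps (\<lambda>n. int (card {s \<in> S. w s = n}))"

text \<open>\<open>card\<close> is 0 on infinite sets, so the product rule for \<open>gf\<close> has
  to keep track of finiteness.\<close>

definition fin_fibres :: "'a set \<Rightarrow> ('a \<Rightarrow> nat) \<Rightarrow> bool" where
  "fin_fibres S w \<longleftrightarrow> (\<forall>n. finite {s \<in> S. w s = n})"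

lemma fibre_Times:
  fixes w :: "'a \<Rightarrow> nat" and u :: "'b \<Rightarrow> nat"
  shows "{p \<in> S \<times> T. (case p of (s, t) \<Rightarrow> w s + u t) = n}
    = (\<Union>i \<in> {0..n}. {s \<in> S. w s = i} \<times> {t \<in> T. u t = n - i})"
  by auto

lemma fin_fibres_Times:
  "fin_fibres S w \<Longrightarrow> fin_fibres T u \<Longrightarrow> fin_fibres (S \<times> T) (\<lambda>(s, t). w s + u t)"
  unfolding fin_fibres_def fibre_Times by simp

lemma gf_Times:
  assumes "fin_fibres S w" "fin_fibres T u"
  shows "gf (S \<times> T) (\<lambda>(s, t). w s + u t) = gf S w * gf T u"
proof (rule fps_ext)
  fix n
  have "card {p \<in> S \<times> T. (case p of (s, t) \<Rightarrow> w s + u t) = n}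
    = (\<Sum>i=0..n. card ({s \<in> S. w s = i} \<times> {t \<in> T. u t = n - i}))"
    unfolding fibre_Times using assms unfolding fin_fibres_def
    by (intro card_UN_disjoint) auto
  then show "fps_nth (gf (S \<times> T) (\<lambda>(s, t). w s + u t)) n = fps_nth (gf S w * gf T u) n"
    by (simp add: gf_def fps_mult_nth card_cartesian_product)
qed

lemma fibre_bij_betw:
  assumes "bij_betw f S T" "\<And>s. s \<in> S \<Longrightarrow> u (f s) = w s"
  shows "bij_betw f {s \<in> S. w s = n} {t \<in> T. u t = n}"
  using assms unfolding bij_betw_def by (auto simp: inj_on_def)

lemma gf_bij_betw:
  assumes "bij_betw f S T" "\<And>s. s \<in> S \<Longrightarrow> u (f s) = w s"
  shows "gf T u = gf S w"
  using bij_betw_same_card[OF fibre_bij_betw[of f S T u w, OF assms]] by (simp add: gf_def)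

lemma fin_fibres_bij_betw:
  assumes "bij_betw f S T" "\<And>s. s \<in> S \<Longrightarrow> u (f s) = w s"
  shows "fin_fibres T u \<longleftrightarrow> fin_fibres S w"
  using bij_betw_finite[OF fibre_bij_betw[of f S T u w, OF assms]] by (simp add: fin_fibres_def)

lemma gf_finite:
  assumes "finite S"
  shows "gf S w = (\<Sum>s\<in>S. q ^ w s)"
proof (rule fps_ext)
  fix n
  have "(\<Sum>s\<in>S. fps_nth (q ^ w s) n) = (\<Sum>s\<in>S. if w s = n then 1 else 0)"
    by (intro sum.cong) (auto simp: fps_X_power_nth)
  also have "\<dots> = int (card {s \<in> S. w s = n})"
    using assms by (simp add: sum.If_cases Int_def)
  finally show "fps_nth (gf S w) n = fps_nth (\<Sum>s\<in>S. q ^ w s) n"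
    by (simp add: gf_def fps_sum_nth)
qed

definition qpos :: "nat \<Rightarrow> int fps" where
  "qpos m = (\<Prod>j=1..m. 1 + q ^ j)"

lemma gf_Pow: "gf (Pow {1..m}) (\<lambda>A. \<Sum>A) = qpos m"
proof (induction m)
  case (Suc m)
  let ?S = "Pow {1..m}"
  have e: "Pow {1..Suc m} = ?S \<union> insert (Suc m) ` ?S"
    by (simp add: atLeastAtMostSuc_conv Pow_insert)
  have inj: "inj_on (insert (Suc m)) ?S"
  proof (rule inj_onI)
    fix A B assume "A \<in> ?S" "B \<in> ?S" and i: "insert (Suc m) A = insert (Suc m) B"
    then have "Suc m \<notin> A" "Suc m \<notin> B" by auto
    then show "A = B" using i by (metis insert_ident)
  qed
  have s: "\<Sum>(insert (Suc m) A) = Suc m + \<Sum>A" if A: "A \<in> ?S" for A :: "nat set"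
  proof -
    have "finite A" "Suc m \<notin> A" using A by (auto intro: finite_subset)
    then show ?thesis by simp
  qed
  have "gf (Pow {1..Suc m}) (\<lambda>A. \<Sum>A) = (\<Sum>A\<in>?S. q ^ \<Sum>A) + (\<Sum>A\<in>insert (Suc m) ` ?S. q ^ \<Sum>A)"
    unfolding e by (subst gf_finite, simp, rule sum.union_disjoint) auto
  also have "(\<Sum>A\<in>insert (Suc m) ` ?S. q ^ \<Sum>A) = (\<Sum>A\<in>?S. q ^ Suc m * q ^ \<Sum>A)"
    unfolding sum.reindex[OF inj] by (intro sum.cong refl) (simp add: s power_add)
  also have "(\<Sum>A\<in>?S. q ^ \<Sum>A) + (\<Sum>A\<in>?S. q ^ Suc m * q ^ \<Sum>A) = (1 + q ^ Suc m) * (\<Sum>A\<in>?S. q ^ \<Sum>A)"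
    by (simp only: sum_distrib_left[symmetric] distrib_right mult_1)
  also have "\<dots> = (1 + q ^ Suc m) * qpos m"
    using Suc by (simp add: gf_finite)
  finally show ?case
    by (simp add: qpos_def mult.commute)
qed (simp add: gf_finite qpos_def)

definition odd_weight :: "nat multiset \<Rightarrow> nat" where
  "odd_weight M = (\<Sum>i\<in>#M. 2 * i + 1)"

text \<open>The copies of the largest element k split off and contribute the geometric series in
  q^(2k+1).\<close>

lemma gf_multisets:
  "fin_fibres {M. set_mset M \<subseteq> {..<k}} odd_weight \<and> gf {M. set_mset M \<subseteq> {..<k}} odd_weight = iqodd k"
proof (induction k)
  case 0
  have "{M :: nat multiset. set_mset M \<subseteq> {..<0}} = {{#}}" by auto
  then show ?case
    by (simp add: fin_fibres_def gf_finite odd_weight_def iqodd_def)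
next
  case (Suc k)
  let ?f = "\<lambda>(M, c). M + replicate_mset c k"
  let ?S = "{M. set_mset M \<subseteq> {..<k}}" and ?T = "{M. set_mset M \<subseteq> {..<Suc k}}"
  let ?w = "\<lambda>(M, c). odd_weight M + (2 * k + 1) * c"
  have b: "bij_betw ?f (?S \<times> UNIV) ?T"
  proof (rule bij_betw_byWitness[where f' = "\<lambda>M. (filter_mset (\<lambda>i. i \<noteq> k) M, count M k)"])
    have "(filter_mset (\<lambda>i. i \<noteq> k) (M + replicate_mset c k), count (M + replicate_mset c k) k) = (M, c)"
      if M: "set_mset M \<subseteq> {..<k}" for M c
    proof -
      have "k \<notin># M" using M by auto
      then show ?thesis
        by (auto simp: multiset_eq_iff not_in_iff)
    qed
    then show "\<forall>p\<in>?S \<times> UNIV. (filter_mset (\<lambda>i. i \<noteq> k) (?f p), count (?f p) k) = p"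
      by auto
    show "\<forall>M\<in>?T. ?f (filter_mset (\<lambda>i. i \<noteq> k) M, count M k) = M"
      by (auto simp: multiset_eq_iff)
    show "?f ` (?S \<times> UNIV) \<subseteq> ?T"
      by (auto split: if_splits)
    show "(\<lambda>M. (filter_mset (\<lambda>i. i \<noteq> k) M, count M k)) ` ?T \<subseteq> ?S \<times> UNIV"
      by (auto simp: less_Suc_eq)
  qed
  have w: "odd_weight (?f p) = ?w p" for p
    by (cases p) (simp add: odd_weight_def)
  have fc: "fin_fibres UNIV (\<lambda>c. (2 * k + 1) * c)"
    unfolding fin_fibres_def
  proof
    fix n
    have "{s \<in> UNIV. (2 * k + 1) * s = n} \<subseteq> {..n}" by auto
    then show "finite {s \<in> UNIV. (2 * k + 1) * s = n}" by (rule finite_subset) simp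
  qed
  have gc: "gf UNIV (\<lambda>c. (2 * k + 1) * c) = geo (2 * k + 1)"
  proof (rule fps_ext)
    fix n
    have "{c. (2 * k + 1) * c = n} = (if 2 * k + 1 dvd n then {n div (2 * k + 1)} else {})"
      by (auto simp del: mult_Suc)
    then show "fps_nth (gf UNIV (\<lambda>c. (2 * k + 1) * c)) n = fps_nth (geo (2 * k + 1)) n"
      by (simp add: gf_def geo_def)
  qed
  have "fin_fibres (?S \<times> UNIV) ?w"
    using Suc fc by (intro fin_fibres_Times) auto
  moreover have "gf (?S \<times> UNIV) ?w = iqodd k * geo (2 * k + 1)"
  proof -
    have "gf (?S \<times> UNIV) ?w = gf ?S odd_weight * gf UNIV (\<lambda>c. (2 * k + 1) * c)"
      using Suc fc by (intro gf_Times) auto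
    then show ?thesis
      unfolding gc using Suc by simp
  qed
  ultimately show ?case
    unfolding fin_fibres_bij_betw[of ?f "?S \<times> UNIV" ?T odd_weight ?w, OF b w]
      gf_bij_betw[of ?f "?S \<times> UNIV" ?T odd_weight ?w, OF b w]
    by (simp add: iqodd_def)
qed

definition side_data :: "nat \<Rightarrow> (nat set \<times> nat set \<times> nat multiset) set" where
  "side_data m = Pow {1..m} \<times> Pow {1..m} \<times> {M. set_mset M \<subseteq> {..<Suc m}}"

text \<open>Half of what the side parts add to the size: an even part 2 x counts x, and an odd part
  2 i + 1, present on both sides, counts 2 i + 1. The nesting matches
  \<open>gf_Times\<close>.\<close>

definition wt :: "nat set \<times> nat set \<times> nat multiset \<Rightarrow> nat" where
  "wt = (\<lambda>(A, p). \<Sum>A + (case p of (B, M) \<Rightarrow> \<Sum>B + odd_weight M))"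

lemma fin_fibres_finite: "finite S \<Longrightarrow> fin_fibres S w"
  by (simp add: fin_fibres_def)

lemma fin_fibres_side_data: "fin_fibres (side_data m) wt"
  and gf_side_data: "gf (side_data m) wt = (qpos m)\<^sup>2 * iqodd (Suc m)"
proof -
  have f: "fin_fibres (Pow {1..m}) (\<lambda>A. \<Sum>A)"
    by (simp add: fin_fibres_finite)
  note g = gf_multisets[of "Suc m"]
  show "fin_fibres (side_data m) wt"
    unfolding side_data_def wt_def using f g by (intro fin_fibres_Times) auto
  show "gf (side_data m) wt = (qpos m)\<^sup>2 * iqodd (Suc m)"
    unfolding side_data_def wt_def using f g
    by (simp add: gf_Times fin_fibres_Times gf_Pow power2_eq_square mult.assoc del: One_nat_def)
qed

definition configs :: "nat \<Rightarrow> (nat \<times> nat set \<times> nat set \<times> nat multiset) set" where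
  "configs n = {(m, c). c \<in> side_data m \<and> m + wt c = n}"

lemma card_configs:
  assumes "n < N"
  shows "int (card (configs n)) = fps_nth (\<Sum>m<N. (qpos m)\<^sup>2 * q ^ m * iqodd (Suc m)) n"
proof -
  have e: "configs n = (SIGMA m:{..n}. {c \<in> side_data m. wt c = n - m})"
    unfolding configs_def by auto
  have "card (configs n) = (\<Sum>m\<le>n. card {c \<in> side_data m. wt c = n - m})"
    unfolding e using fin_fibres_side_data by (intro card_SigmaI) (auto simp: fin_fibres_def)
  then have "int (card (configs n)) = (\<Sum>m\<le>n. fps_nth (gf (side_data m) wt) (n - m))"
    by (simp add: gf_def)
  also have "\<dots> = (\<Sum>m\<le>n. fps_nth (q ^ m * gf (side_data m) wt) n)"
    by (intro sum.cong) (auto simp: fps_X_power_mult_nth)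
  also have "\<dots> = (\<Sum>m<N. fps_nth (q ^ m * gf (side_data m) wt) n)"
    using assms by (intro sum.mono_neutral_left) (auto simp: fps_X_power_mult_nth)
  finally show ?thesis
    by (simp add: gf_side_data fps_sum_nth mult_ac)
qed

text \<open>
  The data \<open>(m, A, B, M)\<close> encode the peak \<open>2 m + 2\<close>, the even parts \<open>2 x\<close> with \<open>x\<close> in \<open>A\<close> on the left and
  in \<open>B\<close> on the right, and the odd parts \<open>2 i + 1\<close> with \<open>i\<close> in \<open>M\<close> on both sides.
\<close>
definition parts :: "nat set \<Rightarrow> nat multiset \<Rightarrow> int multiset" where
  "parts A M = image_mset (\<lambda>x. 2 * int x) (mset_set A) + image_mset (\<lambda>i. 2 * int i + 1) M"

definition seq_of :: "nat \<times> nat set \<times> nat set \<times> nat multiset \<Rightarrow> int list" where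
  "seq_of = (\<lambda>(m, A, B, M). sorted_list_of_multiset (parts A M) @
     (2 * int m + 2) # rev (sorted_list_of_multiset (parts B M)))"

lemma filter_parts:
  "filter_mset even (parts A M) = image_mset (\<lambda>x. 2 * int x) (mset_set A)"
  "filter_mset odd (parts A M) = image_mset (\<lambda>i. 2 * int i + 1) M"
  by (simp_all add: parts_def filter_mset_image_mset)

lemma parts_inject:
  assumes "finite A" "finite B" "parts A M = parts B M'"
  shows "A = B \<and> M = M'"
proof -
  have inj: "inj (\<lambda>x. 2 * int x)" "inj (\<lambda>i. 2 * int i + 1)"
    by (auto simp: inj_on_def)
  have "mset_set A = mset_set B"
    using filter_parts(1)[of A M] filter_parts(1)[of B M'] assms(3) multiset.inj_map[OF inj(1)]
    by (metis injD)
  moreover have "M = M'"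
    using filter_parts(2)[of A M] filter_parts(2)[of B M'] assms(3) multiset.inj_map[OF inj(2)]
    by (metis injD)
  ultimately show ?thesis
    using assms(1,2) by (metis finite_set_mset_mset_set)
qed

lemma parts_range:
  assumes "A \<subseteq> {1..m}" "set_mset M \<subseteq> {..<Suc m}" "x \<in># parts A M"
  shows "0 < x \<and> x < 2 * int m + 2"
proof -
  have "finite A" using assms(1) finite_subset by blast
  then show ?thesis
    using assms unfolding parts_def by fastforce
qed

lemma sum_parts: "sum_mset (parts A M) = 2 * int (\<Sum>A) + int (odd_weight M)"
proof -
  have "sum_mset (image_mset (\<lambda>x. 2 * int x) (mset_set A)) = 2 * int (\<Sum>A)"
    by (simp add: sum_unfold_sum_mset[symmetric] sum_distrib_left)
  moreover have "sum_mset (image_mset (\<lambda>i. 2 * int i + 1) M) = int (odd_weight M)"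
    unfolding odd_weight_def by (induction M) auto
  ultimately show ?thesis by (simp add: parts_def)
qed

text \<open>The peak is the maximum and occurs only once, so it recovers m and splits the list;
  parity then separates the parts on each side.\<close>

lemma inj_on_seq_of: "inj_on seq_of (configs n)"
proof (rule inj_onI)
  fix c c' assume c: "c \<in> configs n" "c' \<in> configs n" and eq: "seq_of c = seq_of c'"
  obtain m A B M where c1: "c = (m, A, B, M)" by (cases c) auto
  obtain m' A' B' M' where c2: "c' = (m', A', B', M')" by (cases c') auto
  have s: "A \<subseteq> {1..m}" "B \<subseteq> {1..m}" "set_mset M \<subseteq> {..<Suc m}"
    "A' \<subseteq> {1..m'}" "B' \<subseteq> {1..m'}" "set_mset M' \<subseteq> {..<Suc m'}"
    using c unfolding c1 c2 configs_def side_data_def by auto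
  have fin: "finite A" "finite B" "finite A'" "finite B'"
    using s finite_subset finite_atLeastAtMost by metis+
  note rng = parts_range[OF s(1,3)] parts_range[OF s(2,3)] parts_range[OF s(4,6)] parts_range[OF s(5,6)]
  have mx: "Max (set (seq_of c)) = 2 * int m + 2" "Max (set (seq_of c')) = 2 * int m' + 2"
    unfolding c1 c2 seq_of_def using rng
    by (auto intro!: Max_eqI simp: less_imp_le)
  then have m: "m = m'" using eq by simp
  have "2 * int m + 2 \<notin> set (sorted_list_of_multiset (parts A M))"
    "2 * int m + 2 \<notin> set (rev (sorted_list_of_multiset (parts B M)))"
    "2 * int m + 2 \<notin> set (sorted_list_of_multiset (parts A' M'))"
    "2 * int m + 2 \<notin> set (rev (sorted_list_of_multiset (parts B' M')))"
    using rng unfolding m by fastforce+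
  then have "sorted_list_of_multiset (parts A M) = sorted_list_of_multiset (parts A' M')"
    "rev (sorted_list_of_multiset (parts B M)) = rev (sorted_list_of_multiset (parts B' M'))"
    using eq unfolding c1 c2 seq_of_def m by (auto simp: append_Cons_eq_iff)
  then have "parts A M = parts A' M'" "parts B M = parts B' M'"
    by (metis mset_sorted_list_of_multiset rev_is_rev_conv)+
  then show "c = c'"
    unfolding c1 c2 m using parts_inject fin by metis
qed

text \<open>Halving with \<open>div\<close> inverts both 2 x and 2 i + 1. The multiset of odd parts
  is given explicitly so that, by balance, the left and right sides can share it.\<close>

lemma parts_preimage:
  assumes "\<forall>x \<in> set L. 0 < x \<and> x < 2 * int m + 2" "distinct (filter even L)"
  shows "\<exists>A \<subseteq> {1..m}. parts A (image_mset (\<lambda>y. nat (y div 2)) (mset (filter odd L))) = mset L"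
proof -
  let ?h = "\<lambda>y :: int. nat (y div 2)"
  let ?E = "set (filter even L)"
  have inj: "inj_on ?h ?E"
    using assms(1) by (auto simp: inj_on_def elim!: evenE)
  have "image_mset (\<lambda>x. 2 * int x) (mset_set (?h ` ?E)) = image_mset (\<lambda>x. 2 * int x) (image_mset ?h (mset (filter even L)))"
    using image_mset_mset_set[OF inj] mset_set_set[OF assms(2)] by simp
  also have "\<dots> = image_mset (\<lambda>y. y) (mset (filter even L))"
    unfolding multiset.map_comp using assms(1) by (intro image_mset_cong) (auto elim!: evenE)
  finally have e: "image_mset (\<lambda>x. 2 * int x) (mset_set (?h ` ?E)) = filter_mset even (mset L)"
    by simp
  have "image_mset (\<lambda>i. 2 * int i + 1) (image_mset ?h (mset (filter odd L))) = image_mset (\<lambda>y. y) (mset (filter odd L))"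
    unfolding multiset.map_comp using assms(1) by (intro image_mset_cong) (auto elim!: oddE)
  then have "parts (?h ` ?E) (image_mset ?h (mset (filter odd L))) = filter_mset even (mset L) + filter_mset odd (mset L)"
    unfolding parts_def e by simp
  also have "\<dots> = mset L"
    by (rule multiset_partition[symmetric])
  finally have "parts (?h ` ?E) (image_mset ?h (mset (filter odd L))) = mset L" .
  moreover have "?h ` ?E \<subseteq> {1..m}"
    using assms(1) by (fastforce elim!: evenE)
  ultimately show ?thesis by blast
qed

lemma sum_list_seq_of:
  "sum_list (seq_of (m, A, B, M)) = 2 * int (m + wt (A, B, M)) + 2"
proof -
  have s: "sum_list (sorted_list_of_multiset N) = sum_mset N" for N :: "int multiset"
    by (metis mset_sorted_list_of_multiset sum_mset_sum_list)
  show ?thesis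
    by (simp add: seq_of_def sum_list_rev s sum_parts wt_def)
qed

lemma distinct_of_mset_set:
  assumes "mset_set S = mset xs" "finite S"
  shows "distinct xs"
  using assms by (metis card_distinct finite_set_mset_mset_set set_mset_mset size_mset size_mset_set)

lemma seq_of_image:
  "seq_of ` configs n = {a. unimodal (2 * int n + 2) a \<and> odd_balanced a}"
proof (intro equalityI subsetI)
  fix a assume "a \<in> seq_of ` configs n"
  then obtain m A B M where c: "(m, A, B, M) \<in> configs n" and a: "a = seq_of (m, A, B, M)"
    by auto
  have s: "A \<subseteq> {1..m}" "B \<subseteq> {1..m}" "set_mset M \<subseteq> {..<Suc m}"
    using c unfolding configs_def side_data_def by auto
  have fin: "finite A" "finite B"
    using s finite_subset finite_atLeastAtMost by metis+
  let ?L = "sorted_list_of_multiset (parts A M)" and ?R = "rev (sorted_list_of_multiset (parts B M))"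
  note rng = parts_range[OF s(1,3)] parts_range[OF s(2,3)]
  have split: "unimodal_split a ?L (2 * int m + 2) ?R"
    unfolding unimodal_split_def a seq_of_def
    using rng by (auto simp: sorted_wrt_rev)
  have "m + wt (A, B, M) = n" using c by (simp add: configs_def)
  then have "unimodal (2 * int n + 2) a"
    unfolding unimodal_def using split sum_list_seq_of[of m A B M] a by auto
  moreover have "odd_balanced a"
    unfolding odd_balanced_def
  proof (intro exI conjI)
    show "unimodal_split a ?L (2 * int m + 2) ?R" by (rule split)
    show "even (2 * int m + 2)" by simp
    have inj: "inj_on (\<lambda>x. 2 * int x) S" for S by (simp add: inj_on_def)
    have "mset_set ((\<lambda>x. 2 * int x) ` A) = mset (filter even ?L)"
      using filter_parts(1)[of A M] by (simp add: image_mset_mset_set inj)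
    then show "distinct (filter even ?L)"
      using distinct_of_mset_set fin by (metis finite_imageI)
    have "mset_set ((\<lambda>x. 2 * int x) ` B) = mset (filter even ?R)"
      using filter_parts(1)[of B M] by (simp add: image_mset_mset_set inj)
    then show "distinct (filter even ?R)"
      using distinct_of_mset_set fin by (metis finite_imageI)
    show "mset (filter odd ?L) = mset (filter odd ?R)"
      using filter_parts(2)[of A M] filter_parts(2)[of B M] by simp
  qed
  ultimately show "a \<in> {a. unimodal (2 * int n + 2) a \<and> odd_balanced a}" by simp
next
  fix a assume "a \<in> {a. unimodal (2 * int n + 2) a \<and> odd_balanced a}"
  then obtain L p R where split: "unimodal_split a L p R" and "even p"
    and d: "distinct (filter even L)" "distinct (filter even R)"
    and o: "mset (filter odd L) = mset (filter odd R)" and sum: "sum_list a = 2 * int n + 2"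
    unfolding odd_balanced_def unimodal_def by blast
  have a: "a = L @ p # R" and pos: "\<forall>x\<in>set a. 0 < x" and LR: "sorted L" "\<forall>x\<in>set L. x < p"
    "sorted_wrt (\<ge>) R" "\<forall>x\<in>set R. x < p"
    using split unfolding unimodal_split_def by auto
  have "0 < p" using pos a by simp
  define m where "m = nat (p div 2 - 1)"
  have p: "p = 2 * int m + 2"
    using \<open>0 < p\<close> \<open>even p\<close> unfolding m_def by (auto elim!: evenE)
  define M where "M = image_mset (\<lambda>y. nat (y div 2)) (mset (filter odd L))"
  have bL: "\<forall>x\<in>set L. 0 < x \<and> x < 2 * int m + 2" and bR: "\<forall>x\<in>set R. 0 < x \<and> x < 2 * int m + 2"
    using pos LR a p by auto
  obtain A where A: "A \<subseteq> {1..m}" "parts A M = mset L"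
    using parts_preimage[OF bL d(1)] unfolding M_def by blast
  obtain B where B: "B \<subseteq> {1..m}" "parts B M = mset R"
    using parts_preimage[OF bR d(2)] unfolding M_def o by blast
  have M: "set_mset M \<subseteq> {..<Suc m}"
    using bL unfolding M_def by auto
  have "sorted (rev R)"
    using LR(3) by (simp add: sorted_wrt_rev)
  then have "sort R = rev R"
    by (intro properties_for_sort) simp_all
  then have seq: "seq_of (m, A, B, M) = a"
    unfolding seq_of_def a p using A B LR(1) by (simp add: sorted_sort_id)
  then have "m + wt (A, B, M) = n"
    using sum sum_list_seq_of[of m A B M] by simp
  then have "(m, A, B, M) \<in> configs n"
    using A B M unfolding configs_def side_data_def by simp
  then show "a \<in> seq_of ` configs n"
    using seq by (metis imageI)
qed

lemma v_eq_coeff: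
  assumes "n < N"
  shows "int (v (int n)) = fps_nth (\<Sum>m<N. (qpos m)\<^sup>2 * q ^ m * iqodd (Suc m)) n"
  using card_configs[OF assms] card_image[OF inj_on_seq_of[of n]]
  by (simp add: v_def seq_of_image)

section \<open>Reduction modulo 4 and translation into a count of triples\<close>

lemma qpos_cong_qfac: "4 dvd (qpos m)\<^sup>2 - (qfac m)\<^sup>2"
proof (induction m)
  case (Suc m)
  have "(qpos (Suc m))\<^sup>2 - (qfac (Suc m))\<^sup>2
    = (1 + q ^ Suc m)\<^sup>2 * ((qpos m)\<^sup>2 - (qfac m)\<^sup>2) + 4 * (q ^ Suc m * (qfac m)\<^sup>2)"
    by (simp add: qpos_def algebra_simps power2_eq_square)
  then show ?case
    using Suc by (simp only: dvd_add dvd_mult dvd_triv_left)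
qed (simp add: qpos_def)

lemma v_cong:
  assumes "n < N"
  shows "[int (v (int n)) = (\<Sum>i<N. fps_nth (hterm i) n)] (mod 4)"
proof -
  have "4 dvd (\<Sum>m<N. (qpos m)\<^sup>2 * q ^ m * iqodd (Suc m)) - (\<Sum>m<N. (qfac m)\<^sup>2 * q ^ m * iqodd (Suc m))"
    unfolding sum_subtractf[symmetric] left_diff_distrib[symmetric]
    by (intro dvd_sum dvd_mult2 qpos_cong_qfac)
  then obtain D where D: "(\<Sum>m<N. (qpos m)\<^sup>2 * q ^ m * iqodd (Suc m)) - (\<Sum>m<N. (qfac m)\<^sup>2 * q ^ m * iqodd (Suc m)) = 4 * D"
    unfolding dvd_def by blast
  have "int (v (int n)) - (\<Sum>i<N. fps_nth (hterm i) n) = fps_nth (4 * D) n"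
    unfolding D[symmetric] v_eq_coeff[OF assms] coeff_partial_sum[OF assms, symmetric] by simp
  then show ?thesis
    by (simp add: cong_iff_dvd_diff numeral_fps_const)
qed

lemma two_tri: "2 * tri j = j * (j + 1)"
  by (simp add: tri_def)

lemma tri_mono: "j \<le> i \<Longrightarrow> tri j \<le> tri i"
  unfolding tri_def by (intro div_le_mono mult_le_mono) simp_all

text \<open>This is k^2 - 1 - j (j + 1) / 2 with k = i + 1; the subtraction is exact for j \<le>
  i.\<close>

definition hexp :: "nat \<Rightarrow> nat \<Rightarrow> nat" where
  "hexp i j = i * (i + 2) - tri j"

lemma hexp_eq: "j \<le> i \<Longrightarrow> hexp i j + tri j = i * (i + 2)"
  using tri_mono[of j i] two_tri[of i] unfolding hexp_def by (simp add: algebra_simps)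

lemma hecke_eq: "q ^ i * hecke (Suc i) = (\<Sum>j\<le>i. q ^ hexp i j)"
proof (induction i)
  case 0
  show ?case by (simp add: hexp_def)
next
  case (Suc i)
  have "hexp (Suc i) j = 2 * i + 3 + hexp i j" if "j \<le> i" for j
    using hexp_eq[of j i] hexp_eq[of j "Suc i"] that by simp
  then have "(\<Sum>j\<le>i. q ^ hexp (Suc i) j) = q ^ (2 * i + 3) * (q ^ i * hecke (Suc i))"
    unfolding Suc sum_distrib_left by (intro sum.cong refl) (simp add: power_add)
  moreover have "hexp (Suc i) (Suc i) = Suc i + tri (Suc i)"
    using hexp_eq[of "Suc i" "Suc i"] two_tri[of "Suc i"] by simp
  ultimately have "(\<Sum>j\<le>Suc i. q ^ hexp (Suc i) j) = q ^ (2 * i + 3) * (q ^ i * hecke (Suc i)) + q ^ (Suc i + tri (Suc i))"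
    by simp
  also have "\<dots> = q ^ Suc i * hecke (Suc (Suc i))"
    by (simp add: algebra_simps power_add eval_nat_numeral)
  finally show ?case ..
qed

lemma nth_lambert:
  assumes "k > 0"
  shows "fps_nth ((1 + q ^ k) * geo k) t = (if k dvd t then if t = 0 then 1 else 2 else 0)"
  using assms by (auto simp: distrib_right fps_X_power_mult_nth geo_def dvd_minus_self dest: dvd_imp_le)

lemma nth_hterm:
  "fps_nth (hterm i) n = (- 1) ^ i * (\<Sum>j\<le>i. if hexp i j \<le> n \<and> Suc i dvd n - hexp i j
     then if n = hexp i j then 1 else 2 else 0)"
proof -
  have "hterm i = (- 1) ^ i * ((q ^ i * hecke (Suc i)) * ((1 + q ^ Suc i) * geo (Suc i)))"
    by (simp only: hterm_def mult_ac)
  also have "\<dots> = fps_const ((- 1) ^ i) * (\<Sum>j\<le>i. q ^ hexp i j * ((1 + q ^ Suc i) * geo (Suc i)))"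
    unfolding hecke_eq sum_distrib_right by (simp flip: fps_const_power fps_const_neg)
  finally have "fps_nth (hterm i) n = (- 1) ^ i * (\<Sum>j\<le>i. fps_nth (q ^ hexp i j * ((1 + q ^ Suc i) * geo (Suc i))) n)"
    by (simp only: fps_mult_left_const_nth fps_sum_nth)
  also have "(\<Sum>j\<le>i. fps_nth (q ^ hexp i j * ((1 + q ^ Suc i) * geo (Suc i))) n) =
     (\<Sum>j\<le>i. if hexp i j \<le> n \<and> Suc i dvd n - hexp i j then if n = hexp i j then 1 else 2 else 0)"
    unfolding fps_X_power_mult_nth nth_lambert[OF zero_less_Suc] by (intro sum.cong refl) auto
  finally show ?thesis .
qed

definition sols :: "nat \<Rightarrow> (nat \<times> nat) set" where
  "sols n = {(i, j). i \<le> n \<and> j \<le> i \<and> hexp i j < n \<and> Suc i dvd n - hexp i j}"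

text \<open>Completing the square in j; this is the origin of 8 n + 7.\<close>

lemma hexp_int:
  assumes "j \<le> i"
  shows "8 * int (hexp i j) = 8 * (int i + 1)\<^sup>2 - (2 * int j + 1)\<^sup>2 - 7"
proof -
  have "int (hexp i j) + int (tri j) = int i * (int i + 2)"
    using hexp_eq[OF assms] by (metis of_nat_add of_nat_mult of_nat_numeral)
  moreover have "2 * int (tri j) = int j * (int j + 1)"
    using two_tri[of j] by (metis of_nat_1 of_nat_add of_nat_mult of_nat_numeral)
  ultimately show ?thesis
    by (simp add: algebra_simps power2_eq_square)
qed

text \<open>The assumption removes the terms with coefficient 1. The remaining ones are even, so the
  sign (-1)^i has no effect modulo 4.\<close>

lemma v_cong_sols:
  assumes "\<And>a x. a > 0 \<Longrightarrow> 8 * a\<^sup>2 - x\<^sup>2 \<noteq> 8 * int n + 7"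
  shows "[int (v (int n)) = 2 * int (card (sols n))] (mod 4)"
proof -
  have ne: "n \<noteq> hexp i j" if "j \<le> i" for i j
    using hexp_int[OF that] assms[of "int i + 1" "2 * int j + 1"] by auto
  have le: "hexp i j \<le> n \<longleftrightarrow> hexp i j < n" if "j \<le> i" for i j
    using ne[OF that] by linarith
  let ?c = "\<lambda>i j. of_bool (hexp i j < n \<and> Suc i dvd n - hexp i j) :: int"
  have "[fps_nth (hterm i) n = 2 * (\<Sum>j\<le>i. ?c i j)] (mod 4)" for i
  proof -
    have "fps_nth (hterm i) n = (- 1) ^ i * (\<Sum>j\<le>i. 2 * ?c i j)"
      unfolding nth_hterm
      by (intro arg_cong[where f = "\<lambda>s. (- 1) ^ i * s"] sum.cong refl) (simp add: le)
    also have "\<dots> = (- 1) ^ i * (2 * (\<Sum>j\<le>i. ?c i j))"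
      by (simp add: sum_distrib_left)
    finally have e: "fps_nth (hterm i) n = (- 1) ^ i * (2 * (\<Sum>j\<le>i. ?c i j))" .
    show ?thesis
      unfolding e by (cases "even i") (auto simp: cong_iff_dvd_diff)
  qed
  then have "[(\<Sum>i<Suc n. fps_nth (hterm i) n) = (\<Sum>i<Suc n. 2 * (\<Sum>j\<le>i. ?c i j))] (mod 4)"
    by (intro cong_sum)
  moreover have "(\<Sum>i<Suc n. 2 * (\<Sum>j\<le>i. ?c i j)) = 2 * int (card (sols n))"
  proof -
    have s: "sols n = (SIGMA i:{..<Suc n}. {j \<in> {..i}. hexp i j < n \<and> Suc i dvd n - hexp i j})"
      unfolding sols_def by auto
    have "int (card (sols n)) = (\<Sum>i<Suc n. int (card {j \<in> {..i}. hexp i j < n \<and> Suc i dvd n - hexp i j}))"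
      unfolding s by (subst card_SigmaI) simp_all
    also have "\<dots> = (\<Sum>i<Suc n. \<Sum>j\<le>i. ?c i j)"
      by (intro sum.cong refl) (simp add: of_bool_def sum.If_cases Int_def)
    finally show ?thesis by (simp only: sum_distrib_left)
  qed
  ultimately show ?thesis
    using v_cong[of n "Suc n"] cong_trans by fastforce
qed

text \<open>If n = \<open>hexp i j\<close> + (i + 1) l with l > 0, put a = i + 1, b = a + l, x = 2 j
  + 1; then 8 a b - x^2 = 8 n + 7, and j \<le> i becomes x < 2 a.\<close>

lemma card_sols:
  "card (sols n) = card {(a, b, x). 0 < x \<and> x < 2 * a \<and> a < b \<and> 8 * a * b - x\<^sup>2 = 8 * int n + 7}"
    (is "_ = card ?S")
proof (rule bij_betw_same_card[OF bij_betw_byWitness])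
  let ?f = "\<lambda>(i, j). (int i + 1, int i + 1 + int ((n - hexp i j) div Suc i), 2 * int j + 1)"
  let ?g = "\<lambda>(a, b :: int, x). (nat (a - 1), nat (x div 2))"
  show "\<forall>s\<in>sols n. ?g (?f s) = s"
    by auto
  have inv: "\<exists>i j. a = int i + 1 \<and> x = 2 * int j + 1 \<and> (i, j) \<in> sols n \<and> b = a + int ((n - hexp i j) div Suc i)"
    if S: "(a, b, x) \<in> ?S" for a b x
  proof -
    have h: "0 < x" "x < 2 * a" "a < b" "8 * a * b - x\<^sup>2 = 8 * int n + 7"
      using S by auto
    have "x\<^sup>2 = 2 * (4 * (a * b) - 4 * int n - 4) + 1"
      using h(4) by (simp add: algebra_simps)
    then have "odd (x\<^sup>2)" by simp
    then have "odd x" by simp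
    define i j where "i = nat (a - 1)" and "j = nat (x div 2)"
    have ij: "a = int i + 1" "x = 2 * int j + 1"
      using h \<open>odd x\<close> unfolding i_def j_def by (auto elim!: oddE)
    obtain l where l: "b = a + int l" "l > 0"
      using h(3) by (metis less_imp_le pos_int_cases zle_iff_zadd zless_iff_Suc_zadd zero_less_Suc)
    have ji: "j \<le> i" using h ij by simp
    have "8 * int n = 8 * (int (hexp i j) + (int i + 1) * int l)"
      using hexp_int[OF ji] h(4) unfolding ij l by (simp add: algebra_simps power2_eq_square)
    then have "int n = int (hexp i j + Suc i * l)"
      by (simp add: algebra_simps)
    then have n: "n = hexp i j + Suc i * l" by linarith
    have "i \<le> n" using n l(2) by (cases l) auto
    then have "(i, j) \<in> sols n"
      using n l(2) ji by (auto simp: sols_def simp del: mult_Suc)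
    moreover have "(n - hexp i j) div Suc i = l"
      using n by (simp del: mult_Suc)
    ultimately show ?thesis using ij l by auto
  qed
  show "\<forall>t\<in>?S. ?f (?g t) = t"
  proof
    fix t assume t: "t \<in> ?S"
    obtain a b x where tx: "t = (a, b, x)" by (cases t) auto
    then show "?f (?g t) = t"
      using inv[of a b x] t by auto
  qed
  show "?g ` ?S \<subseteq> sols n"
  proof (rule image_subsetI)
    fix t assume t: "t \<in> ?S"
    obtain a b x where tx: "t = (a, b, x)" by (cases t) auto
    then show "?g t \<in> sols n"
      using inv[of a b x] t by auto
  qed
  show "?f ` sols n \<subseteq> ?S"
  proof (rule image_subsetI)
    fix s assume s: "s \<in> sols n"
    obtain i j where sx: "s = (i, j)" by (cases s)
    have h: "j \<le> i" "hexp i j < n" "Suc i dvd n - hexp i j"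
      using s unfolding sx sols_def by auto
    then obtain l where l: "n - hexp i j = Suc i * l" by blast
    then have n: "n = hexp i j + Suc i * l" and "l > 0"
      using h(2) by (cases l; simp)+
    have "(n - hexp i j) div Suc i = l"
      unfolding l by (simp del: mult_Suc)
    moreover have "8 * int n = 8 * int (hexp i j) + 8 * ((int i + 1) * int l)"
      unfolding n by (simp add: algebra_simps)
    ultimately show "?f s \<in> ?S"
      using hexp_int[OF h(1)] h(1) \<open>l > 0\<close> unfolding sx
      by (simp add: algebra_simps power2_eq_square)
  qed
qed

theorem theorem4p1:
  fixes p \<delta> k n :: int
  assumes "prime p" and "odd p"
    and "\<not> [p = 1] (mod 8)" and "\<not> [p = - 1] (mod 8)"
    and "[8 * \<delta> = 1] (mod p\<^sup>2)"
    and "Legendre k p = 1"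
  shows "[v (p\<^sup>2 * n + (p * k - 7) * \<delta>) = 0] (mod 4)"
proof (cases "p\<^sup>2 * n + (p * k - 7) * \<delta> < 0")
  case True
  then show ?thesis by (simp add: v_def)
next
  case False
  then obtain N where N: "p\<^sup>2 * n + (p * k - 7) * \<delta> = int N"
    by (metis linorder_not_less nonneg_int_cases)
  define m where "m = 8 * int N + 7"
  obtain t where t: "8 * \<delta> - 1 = p\<^sup>2 * t"
    using assms(5) unfolding cong_iff_dvd_diff by blast
  \<comment> \<open>Multiplying the argument of \<open>v\<close> by 8 and using 8 \<delta> = 1 + p^2
    t shows that m is p k modulo p^2; m' is the exact quotient m / p.\<close>
  define m' where "m' = k + p * (8 * n + (p * k - 7) * t)"
  have "m = p * k + 8 * p\<^sup>2 * n + (p * k - 7) * (8 * \<delta> - 1)"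
    unfolding m_def N[symmetric] by (simp add: algebra_simps)
  then have m: "m = p * m'"
    unfolding t m'_def by (simp add: algebra_simps power2_eq_square)
  have "[m' = k] (mod p)"
    unfolding m'_def by (simp add: cong_iff_dvd_diff)
  then have "Legendre m' p = 1"
    using Legendre_cong assms(6) by metis
  moreover have "p mod 8 \<noteq> 7"
    using assms(4) by (simp add: cong_def)
  moreover have "m mod 8 = 7" "m > 0"
    by (simp_all add: m_def)
  ultimately interpret inert_disc p m' m
    using assms(1,2) Legendre_2[OF assms(1-4)] m
    by unfold_locales simp_all
  have "even (card (sols N))"
    unfolding card_sols using even_card_ordered unfolding m_def .
  then have "4 dvd 2 * int (card (sols N))" by (auto elim!: evenE)
  moreover have "[int (v (int N)) = 2 * int (card (sols N))] (mod 4)"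
    using no_diagonal_solution unfolding m_def by (intro v_cong_sols)
  ultimately have "4 dvd int (v (int N))"
    using cong_dvd_iff by blast
  then have "4 dvd v (int N)"
    by presburger
  then show ?thesis
    unfolding N by (simp add: cong_0_iff)
qed

end
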